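(* Let $\mathcal{H}(T,A,\mu)$ and $\mathcal{H}(\tilde T,\tilde A,\tilde\mu)$ be two Cauchy--de Branges spaces of the convergence class and of finite order, and let $$B_\gamma(z)=A(z)\Big(\gamma+\sum_n\frac{\mu_n}{t_n-z}\Big),\qquad \tilde B_\gamma(z)=\tilde A(z)\Big(\gamma+\sum_n\frac{\tilde\mu_n}{\tilde t_n-z}\Big).$$ If there exist $\alpha,\beta\in\mathbb{C}\setminus\{0\}$, $\alpha\ne\beta$, such that $\mathcal{Z}(B_\alpha)=\mathcal{Z}(\tilde B_\alpha)$ and $\mathcal{Z}(B_\beta)=\mathcal{Z}(\tilde B_\beta)$ (counting multiplicities), then $\tilde T=T$, $\tilde\mu=\mu$ (i.e. $\tilde\mu_n=\mu_n$ at each point $t_n$) and $\tilde A=SA$ for some entire function $S$ without zeros.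
   Context: Let $T=\{t_n\}_{n\ge1}\subset\mathbb{C}$ be a set of distinct points with $|t_n|\to\infty$, and let $\mu_n>0$ satisfy $\sum_n\frac{\mu_n}{|t_n|^2+1}<\infty$; write $\mu=\sum_n\mu_n\delta_{t_n}$. Let $A$ be an entire function with simple zeros exactly at the points of $T$ and no other zeros. The Cauchy--de Branges space is $\mathcal{H}(T,A,\mu)=\{F(z)=A(z)\sum_n\frac{c_n\mu_n^{1/2}}{z-t_n}:(c_n)\in\ell^2\}$ with norm $\|F\|=\|(c_n)\|_{\ell^2}$. It is of the convergence class if $\sum_n\frac{\mu_n}{|t_n|+1}<\infty$, and of finite order if all its elements are entire functions of finite order (equivalently, $A$ has finite order). $\mathcal{Z}(f)$ denotes the zero set of $f$. *)

theory Defs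
  imports "HOL-Complex_Analysis.Complex_Analysis"
begin

definition finite_order :: "(complex \<Rightarrow> complex) \<Rightarrow> bool" where
  "finite_order f \<longleftrightarrow> (\<exists>\<rho>::real. \<exists>C::real. \<forall>z. norm (f z) \<le> C * exp (norm z powr \<rho>))"

definition CdB_data :: "(nat \<Rightarrow> complex) \<Rightarrow> (nat \<Rightarrow> real) \<Rightarrow> (complex \<Rightarrow> complex) \<Rightarrow> bool" where
  "CdB_data T mu A \<longleftrightarrow>
     inj T \<and> filterlim (\<lambda>n. norm (T n)) at_top sequentially \<and>
     (\<forall>n. mu n > 0) \<and> summable (\<lambda>n. mu n / ((norm (T n))\<^sup>2 + 1)) \<and>
     A holomorphic_on UNIV \<and> {z. A z = 0} = range T \<and> (\<forall>n. deriv A (T n) \<noteq> 0)"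

definition CdB_convergence_class :: "(nat \<Rightarrow> complex) \<Rightarrow> (nat \<Rightarrow> real) \<Rightarrow> bool" where
  "CdB_convergence_class T mu \<longleftrightarrow> summable (\<lambda>n. mu n / (norm (T n) + 1))"

text \<open>Finite order of the space: equivalently, A has finite order.\<close>
definition CdB_finite_order :: "(complex \<Rightarrow> complex) \<Rightarrow> bool" where
  "CdB_finite_order A \<longleftrightarrow> finite_order A"

text \<open>B_gamma(z) = A(z)(gamma + sum mu_n/(t_n - z)), extended to the entire function;
  at z = t_m the value is the limit -mu_m A'(t_m).\<close>
definition CdB_B :: "(nat \<Rightarrow> complex) \<Rightarrow> (nat \<Rightarrow> real) \<Rightarrow> (complex \<Rightarrow> complex) \<Rightarrow> complex \<Rightarrow> complex \<Rightarrow> complex" where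
  "CdB_B T mu A \<gamma> z =
     (if z \<in> range T then - of_real (mu (inv T z)) * deriv A z
      else A z * (\<gamma> + (\<Sum>n. of_real (mu n) / (T n - z))))"

definition same_zeros_mult :: "(complex \<Rightarrow> complex) \<Rightarrow> (complex \<Rightarrow> complex) \<Rightarrow> bool" where
  "same_zeros_mult f g \<longleftrightarrow>
     (\<forall>z. (f z = 0 \<longleftrightarrow> g z = 0) \<and> (f z = 0 \<longrightarrow> zorder f z = zorder g z))"

end

theory Submission
  imports Defs
begin

text \<open>Since \<open>B\<^sub>\<alpha>\<close> and its counterpart are entire functions of finite order with the same zeros, their
  quotient is \<open>exp p\<close> with \<open>p\<close> a polynomial; likewise the quotient for \<open>\<beta>\<close> is \<open>exp q\<close>.
  Let \<open>\<phi>\<close>, \<open>\<phi>'\<close> be the two Cauchy transforms. Then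
  \<open>exp (p - q) * ((\<alpha> + \<phi>) * (\<beta> + \<phi>')) = (\<beta> + \<phi>) * (\<alpha> + \<phi>')\<close> off the poles. In the convergence class
  \<open>\<phi>\<close> and \<open>\<phi>'\<close> tend to \<open>0\<close> in mean, so every sector contains points tending to infinity along which both
  tend to \<open>0\<close>, and there \<open>exp (p - q)\<close> tends to \<open>1\<close>. A nonconstant \<open>p - q\<close> has real part at least \<open>1\<close>
  far out in some sector, hence \<open>exp (p - q) = 1\<close>. Subtracting the relations for \<open>\<alpha>\<close> and \<open>\<beta>\<close> gives
  \<open>A' = exp p * A\<close>, and comparing the values at the points \<open>t\<^sub>n\<close> gives equality of the masses.\<close>

subsection \<open>Points where a sum of simple poles is small\<close>

text \<open>The singularity at \<open>a\<close> is integrable, and by subadditivity of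
  \<open>sqrt\<close> each of the two halves of the antiderivative grows by at most
  \<open>2 * sqrt L\<close>. The bound is uniform in \<open>a\<close> and \<open>p\<close>, as the
  averaging below requires.\<close>

lemma has_integral_inverse_sqrt_dist:
  fixes a p L :: real
  assumes "L > 0"
  shows "\<exists>I. ((\<lambda>x. 1 / sqrt \<bar>x - a\<bar>) has_integral I) {p..p+L} \<and> I \<le> 4 * sqrt L"
proof -
  define G where "G = (\<lambda>x. 2 * sgn (x - a) * sqrt \<bar>x - a\<bar>)"
  \<comment> \<open>This form shows continuity across \<open>a\<close>, where \<open>G\<close> is
    not differentiable; the fundamental theorem tolerates that one exceptional point.\<close>
  have G_alt: "G x = 2 * sqrt (max 0 (x - a)) - 2 * sqrt (max 0 (a - x))" for x
    by (auto simp: G_def sgn_if max_def)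
  have "((\<lambda>x. 1 / sqrt \<bar>x - a\<bar>) has_integral (G (p+L) - G p)) {p..p+L}"
  proof (rule fundamental_theorem_of_calculus_interior_strong[of "{a}"])
    show "continuous_on {p..p+L} G"
      unfolding G_alt by (intro continuous_intros)
  next
    fix x assume "x \<in> {p<..<p+L} - {a}"
    then have "x \<noteq> a" by auto
    then consider "x > a" | "x < a" by linarith
    then have "(G has_real_derivative (1 / sqrt \<bar>x - a\<bar>)) (at x)"
    proof cases
      case 1
      have "((\<lambda>x. 2 * sqrt (x - a)) has_real_derivative (1 / sqrt \<bar>x - a\<bar>)) (at x)"
        using 1 by (auto intro!: derivative_eq_intros simp: field_simps)
      then show ?thesis
        by (rule has_field_derivative_transform_within_open[of _ _ _ "{a<..}"])
           (use 1 in \<open>auto simp: G_def\<close>)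
    next
      case 2
      have "((\<lambda>x. - 2 * sqrt (a - x)) has_real_derivative (1 / sqrt \<bar>x - a\<bar>)) (at x)"
        using 2 by (auto intro!: derivative_eq_intros simp: field_simps)
      then show ?thesis
        by (rule has_field_derivative_transform_within_open[of _ _ _ "{..<a}"])
           (use 2 in \<open>auto simp: G_def\<close>)
    qed
    then show "(G has_vector_derivative (1 / sqrt \<bar>x - a\<bar>)) (at x)"
      by (simp add: has_real_derivative_iff_has_vector_derivative)
  qed (use assms in auto)
  moreover have "G (p+L) - G p \<le> 4 * sqrt L"
  proof -
    have "sqrt (max 0 (p + L - a)) \<le> sqrt (max 0 (p - a)) + sqrt L"
      using assms by (intro order_trans[OF _ sqrt_add_le_add_sqrt]) (auto simp: max_def)
    moreover have "sqrt (max 0 (a - p)) \<le> sqrt (max 0 (a - (p + L))) + sqrt L"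
      using assms by (intro order_trans[OF _ sqrt_add_le_add_sqrt]) (auto simp: max_def)
    ultimately show ?thesis
      unfolding G_alt by linarith
  qed
  ultimately show ?thesis by blast
qed

text \<open>A mean value argument: the integral of the sum over the interval is at most
  \<open>4 * sqrt L\<close> times the total mass, hence less than \<open>K * L\<close>, so the sum
  cannot be at least \<open>K\<close> throughout.\<close>

lemma exists_point_small_inverse_sqrt_sum:
  fixes m a :: "'i \<Rightarrow> real"
  assumes "finite I" and m: "\<And>i. i \<in> I \<Longrightarrow> m i \<ge> 0"
    and L: "L > 0" and K: "4 * (\<Sum>i\<in>I. m i) / sqrt L < K"
  shows "\<exists>x\<in>{p..p+L}. (\<forall>i\<in>I. x \<noteq> a i) \<and> (\<Sum>i\<in>I. m i / sqrt \<bar>x - a i\<bar>) < K"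
proof (rule ccontr)
  assume neg: "\<not> ?thesis"
  obtain J where J: "\<And>i. ((\<lambda>x. 1 / sqrt \<bar>x - a i\<bar>) has_integral J i) {p..p+L}"
    "\<And>i. J i \<le> 4 * sqrt L"
  proof -
    have "\<forall>i. \<exists>I. ((\<lambda>x. 1 / sqrt \<bar>x - a i\<bar>) has_integral I) {p..p+L} \<and> I \<le> 4 * sqrt L"
      using has_integral_inverse_sqrt_dist[OF L] by blast
    from choice[OF this] show ?thesis using that by blast
  qed
  have "((\<lambda>x. \<Sum>i\<in>I. m i * (1 / sqrt \<bar>x - a i\<bar>)) has_integral (\<Sum>i\<in>I. m i * J i)) {p..p+L}"
    using \<open>finite I\<close> by (intro has_integral_sum has_integral_mult_right J)
  \<comment> \<open>At the points \<open>a i\<close> one summand is a division by zero, with value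
    0, and \<open>neg\<close> says nothing there; changing finitely many values to \<open>K\<close>
    leaves the integral unchanged.\<close>
  then have spiked: "((\<lambda>x. if x \<in> a ` I then K else \<Sum>i\<in>I. m i / sqrt \<bar>x - a i\<bar>)
      has_integral (\<Sum>i\<in>I. m i * J i)) {p..p+L}"
    by (rule has_integral_spike_finite[of "a ` I", rotated 2]) (use \<open>finite I\<close> in auto)
  have "((\<lambda>x. K) has_integral (K * L)) {p..p+L}"
    using has_integral_const_real[of K p "p+L"] L by (simp add: mult.commute)
  from this spiked have "K * L \<le> (\<Sum>i\<in>I. m i * J i)"
  proof (rule has_integral_le)
    fix x assume x: "x \<in> {p..p+L}"
    show "K \<le> (if x \<in> a ` I then K else \<Sum>i\<in>I. m i / sqrt \<bar>x - a i\<bar>)"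
    proof (cases "x \<in> a ` I")
      case False
      then have "\<forall>i\<in>I. x \<noteq> a i" by auto
      with neg x have "\<not> (\<Sum>i\<in>I. m i / sqrt \<bar>x - a i\<bar>) < K" by blast
      with False show ?thesis by auto
    qed auto
  qed
  also have "\<dots> \<le> (\<Sum>i\<in>I. m i * (4 * sqrt L))"
    by (intro sum_mono mult_left_mono J m)
  also have "\<dots> = 4 * sqrt L * (\<Sum>i\<in>I. m i)"
    by (simp add: sum_distrib_right[symmetric])
  also have "\<dots> < sqrt L * (sqrt L * K)"
    using K L by (simp add: pos_divide_less_eq mult.commute)
  also have "\<dots> = K * L"
    using L by simp
  finally show False
    by simp
qed

text \<open>As \<open>1/\<bar>z - t\<bar> \<le> 1 / (sqrt \<bar>Re (z - t)\<bar> * sqrt \<bar>Im (z - t)\<bar>)\<close>, the real and the imaginary part of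
  the point can be chosen one after the other by the one-dimensional lemma.\<close>

lemma exists_point_small_inverse_dist_sum:
  fixes m :: "'i \<Rightarrow> real" and t :: "'i \<Rightarrow> complex"
  assumes "finite I" and m: "\<And>i. i \<in> I \<Longrightarrow> m i \<ge> 0"
    and L: "L > 0" and K: "16 * (\<Sum>i\<in>I. m i) / L < K"
  shows "\<exists>z. Re z \<in> {p..p+L} \<and> Im z \<in> {q..q+L} \<and> (\<forall>i\<in>I. z \<noteq> t i) \<and>
     (\<Sum>i\<in>I. m i / norm (z - t i)) < K"
proof -
  have L2: "L = sqrt L * sqrt L" using L by simp
  \<comment> \<open>The threshold for the real part is chosen so that the second application, with
    weights \<open>m i / sqrt \<bar>x - Re (t i)\<bar>\<close>, has threshold exactly
    \<open>K\<close>; the two factors \<open>4 / sqrt L\<close> make up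
    \<open>16 / L\<close>.\<close>
  have "4 * (\<Sum>i\<in>I. m i) / sqrt L < sqrt L * K / 4"
    using K L by (subst (asm) L2) (simp add: field_simps del: real_sqrt_mult_self)
  from exists_point_small_inverse_sqrt_sum[of I m, OF assms(1) m L this, of p "\<lambda>i. Re (t i)"]
  obtain x where x: "x \<in> {p..p+L}" "\<And>i. i \<in> I \<Longrightarrow> x \<noteq> Re (t i)"
    "(\<Sum>i\<in>I. m i / sqrt \<bar>x - Re (t i)\<bar>) < sqrt L * K / 4" by blast
  have "4 * (\<Sum>i\<in>I. m i / sqrt \<bar>x - Re (t i)\<bar>) / sqrt L < K"
    using x(3) L by (simp add: field_simps)
  from exists_point_small_inverse_sqrt_sum[of I "\<lambda>i. m i / sqrt \<bar>x - Re (t i)\<bar>",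
      OF assms(1) _ L this, of q "\<lambda>i. Im (t i)"]
  obtain y where y: "y \<in> {q..q+L}" "\<And>i. i \<in> I \<Longrightarrow> y \<noteq> Im (t i)"
    "(\<Sum>i\<in>I. m i / sqrt \<bar>x - Re (t i)\<bar> / sqrt \<bar>y - Im (t i)\<bar>) < K"
    using m by fastforce
  define z where "z = Complex x y"
  have "m i / norm (z - t i) \<le> m i / sqrt \<bar>x - Re (t i)\<bar> / sqrt \<bar>y - Im (t i)\<bar>" if "i \<in> I" for i
  proof -
    define X Y where "X = \<bar>x - Re (t i)\<bar>" and "Y = \<bar>y - Im (t i)\<bar>"
    have XY: "X > 0" "Y > 0" using x(2) y(2) that by (auto simp: X_def Y_def)
    have "2 * (X * Y) \<le> X\<^sup>2 + Y\<^sup>2"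
      using zero_le_power2[of "X - Y"] by (simp add: power2_eq_square algebra_simps)
    then have "X * Y \<le> X\<^sup>2 + Y\<^sup>2"
      using mult_pos_pos[OF XY] by linarith
    then have "sqrt (X * Y) \<le> norm (z - t i)"
      unfolding cmod_def z_def by (simp add: X_def Y_def)
    then have "m i / norm (z - t i) \<le> m i / sqrt (X * Y)"
      using m[OF that] XY less_le_trans[of 0 "sqrt (X * Y)" "norm (z - t i)"]
      by (intro divide_left_mono mult_pos_pos) auto
    then show ?thesis by (simp add: X_def Y_def real_sqrt_mult)
  qed
  then have "(\<Sum>i\<in>I. m i / norm (z - t i)) < K"
    by (intro order_le_less_trans[OF sum_mono y(3)])
  moreover have "Re z \<in> {p..p+L}" "Im z \<in> {q..q+L}" "\<forall>i\<in>I. z \<noteq> t i"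
    using x(1,2) y(1) by (auto simp: z_def complex_eq_iff)
  ultimately show ?thesis by blast
qed

subsection \<open>Zero-free quotients of entire functions of finite order\<close>

text \<open>After scaling, \<open>g\<close> takes values in the half-plane \<open>Re < D\<close>,
  which \<open>g / (2 * D - g)\<close> maps into the unit disc, fixing 0. The Schwarz lemma at
  points of modulus at most 1/2 then gives the bound.\<close>

lemma Borel_Caratheodory_half:
  assumes f: "f holomorphic_on ball 0 R" and R: "R > 0"
    and M: "\<And>z. z \<in> ball 0 R \<Longrightarrow> Re (f z) \<le> M" and z: "norm z \<le> R / 2"
  shows "norm (f z - f 0) \<le> 2 * (M - Re (f 0))"
proof (rule field_le_epsilon)
  fix e :: real assume e: "e > 0"
  \<comment> \<open>The slack \<open>e / 2\<close> makes \<open>D\<close> strictly positive even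
    when \<open>Re (f 0) = M\<close>.\<close>
  define D where "D = M + e / 2 - Re (f 0)"
  have D: "D > 0" using M[of 0] R e by (simp add: D_def)
  define g where "g = (\<lambda>w. f (of_real R * w) - f 0)"
  define h where "h = (\<lambda>w. g w / (2 * of_real D - g w))"
  have dom: "of_real R * w \<in> ball 0 R" if "norm w < 1" for w :: complex
    using that R by (simp add: norm_mult)
  have Reg: "Re (g w) < D" if "norm w < 1" for w
    using M[OF dom[OF that]] e by (simp add: g_def D_def)
  have lt: "norm (g w) < norm (2 * of_real D - g w)" if "norm w < 1" for w
  proof -
    have "0 < 4 * D * (D - Re (g w))"
      using D Reg[OF that] by simp
    then have "(Re (g w))\<^sup>2 + (Im (g w))\<^sup>2 < (2 * D - Re (g w))\<^sup>2 + (Im (g w))\<^sup>2"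
      by (simp add: power2_eq_square algebra_simps)
    then show ?thesis
      by (simp add: cmod_def)
  qed
  have "h holomorphic_on ball 0 1"
  proof -
    have "(f \<circ> (\<lambda>w. of_real R * w)) holomorphic_on ball 0 1"
      by (rule holomorphic_on_compose_gen[OF _ f]) (use dom in \<open>auto intro!: holomorphic_intros\<close>)
    then have "g holomorphic_on ball 0 1"
      unfolding g_def o_def by (intro holomorphic_intros)
    moreover have "2 * of_real D - g w \<noteq> 0" if "w \<in> ball 0 1" for w
      using lt[of w] that by auto
    ultimately show ?thesis
      unfolding h_def by (intro holomorphic_intros) auto
  qed
  moreover have "norm (h w) < 1" if "norm w < 1" for w
    using lt[OF that] by (simp add: h_def norm_divide divide_less_eq_1)
  moreover have "h 0 = 0" by (simp add: h_def g_def)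
  moreover define w where "w = z / of_real R"
  have w: "norm w \<le> 1/2" using z R by (simp add: w_def norm_divide field_simps)
  ultimately have "norm (h w) \<le> norm w"
    by (intro Schwarz_Lemma(1)) auto
  then have "norm (h w) \<le> 1/2" using w by linarith
  moreover have "norm (2 * of_real D - g w) > 0" using lt[of w] w norm_ge_zero[of "g w"] by linarith
  ultimately have "2 * norm (g w) \<le> norm (2 * of_real D - g w)"
    by (simp add: h_def norm_divide field_simps)
  also have "\<dots> \<le> 2 * D + norm (g w)"
    using norm_triangle_ineq4[of "2 * of_real D" "g w"] D by (simp add: norm_mult)
  finally have "norm (g w) \<le> 2 * D" by simp
  then show "norm (f z - f 0) \<le> 2 * (M - Re (f 0)) + e"
    using R by (simp add: g_def w_def D_def)
qed

text \<open>The point \<open>b\<close> rules out that \<open>f\<close> vanishes identically.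
  \<open>zor_poly\<close> is controlled only near \<open>a\<close>, so the cofactor is glued from it
  and the plain quotient away from \<open>a\<close>.\<close>

lemma entire_factor_zero:
  assumes f: "f holomorphic_on UNIV" and "f a = 0" "f b \<noteq> 0"
  shows "\<exists>n g. g holomorphic_on UNIV \<and> g a \<noteq> 0 \<and> (\<forall>z. f z = (z - a) ^ n * g z)"
proof -
  define n where "n = nat (zorder f a)"
  have "0 < zorder f a \<and> (\<exists>r>0. zor_poly f a holomorphic_on cball a r \<and>
     (\<forall>w\<in>cball a r. f w = zor_poly f a w * (w - a) ^ n \<and> zor_poly f a w \<noteq> 0))"
    using zorder_exist_zero[OF f open_UNIV connected_UNIV UNIV_I, of a] assms(2,3)
    by (auto simp: n_def)
  then obtain r where r: "r > 0" "zor_poly f a holomorphic_on cball a r"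
    "\<And>w. w \<in> cball a r \<Longrightarrow> f w = zor_poly f a w * (w - a) ^ n \<and> zor_poly f a w \<noteq> 0"
    and "zorder f a > 0"
    by blast
  then have n: "n > 0" by (simp add: n_def)
  define g where "g = (\<lambda>z. if z = a then zor_poly f a a else f z / (z - a) ^ n)"
  have "g holomorphic_on (UNIV - {a})"
    by (rule holomorphic_transform[of "\<lambda>z. f z / (z - a) ^ n"])
       (auto simp: g_def intro!: holomorphic_intros holomorphic_on_subset[OF f])
  moreover have "g holomorphic_on ball a r"
    by (rule holomorphic_transform[OF holomorphic_on_subset[OF r(2)]])
       (use r(3) in \<open>auto simp: g_def\<close>)
  ultimately have "g holomorphic_on ((UNIV - {a}) \<union> ball a r)"
    by (intro holomorphic_on_Un) auto
  moreover have "(UNIV - {a}) \<union> ball a r = UNIV" using r(1) by auto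
  ultimately have "g holomorphic_on UNIV" by simp
  moreover have "g a \<noteq> 0" using r(1) r(3)[of a] by (simp add: g_def)
  moreover have "f z = (z - a) ^ n * g z" for z
    using n assms(2) by (simp add: g_def)
  ultimately show ?thesis by blast
qed

text \<open>The factor \<open>p\<close> is the product of the \<open>1 - z/a\<close> over the zeros \<open>a\<close> in the disc of radius \<open>R\<close>. Because
  it is at least \<open>1\<close> on the circle of radius \<open>3 R\<close>, dividing by it does not increase the maximum there.\<close>

lemma entire_divide_zeros:
  assumes "f holomorphic_on UNIV" and "f 0 \<noteq> 0" and R: "R > 0"
  shows "\<exists>p g. p holomorphic_on UNIV \<and> g holomorphic_on UNIV \<and> (\<forall>z. f z = p z * g z) \<and>
    p 0 = 1 \<and> (\<forall>z. norm z = 3 * R \<longrightarrow> norm (p z) \<ge> 1) \<and> (\<forall>z\<in>cball 0 R. g z \<noteq> 0)"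
  using assms(1,2)
proof (induction "card {z \<in> cball 0 R. f z = 0}" arbitrary: f rule: less_induct)
  case less
  show ?case
  proof (cases "{z \<in> cball 0 R. f z = 0} = {}")
    case True
    then show ?thesis
      using less.prems by (intro exI[of _ "\<lambda>_. 1"] exI[of _ f]) auto
  next
    case False
    then obtain a where a: "a \<in> cball 0 R" "f a = 0" by blast
    obtain n g where g: "g holomorphic_on UNIV" "g a \<noteq> 0" "\<And>z. f z = (z - a) ^ n * g z"
      using entire_factor_zero[OF less.prems(1) a(2) less.prems(2)] by blast
    have a0: "a \<noteq> 0" using a less.prems by auto
    have fin: "finite {z \<in> cball 0 R. f z = 0}"
    proof (rule holomorphic_compact_finite_zeros[OF less.prems(1)])
      show "\<not> f constant_on UNIV"
        using a(2) less.prems(2) by (metis UNIV_I constant_on_def)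
    qed auto
    \<comment> \<open>The constant turns the factor \<open>(z - a) ^ n\<close> into
      \<open>(1 - z / a) ^ n\<close>, which has value 1 at the origin.\<close>
    define h where "h = (\<lambda>z. (- a) ^ n * g z)"
    have fh: "f z = (1 - z / a) ^ n * h z" for z
    proof -
      have "(1 - z / a) * (- a) = z - a" using a0 by (simp add: field_simps)
      then show ?thesis
        by (simp add: g(3) h_def power_mult_distrib[symmetric] mult.assoc[symmetric])
    qed
    have "h a \<noteq> 0" using g(2) a0 by (simp add: h_def)
    then have "{z \<in> cball 0 R. h z = 0} \<subseteq> {z \<in> cball 0 R. f z = 0} - {a}"
      by (auto simp: fh)
    then have "{z \<in> cball 0 R. h z = 0} \<subset> {z \<in> cball 0 R. f z = 0}"
      using a by blast
    then have "card {z \<in> cball 0 R. h z = 0} < card {z \<in> cball 0 R. f z = 0}"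
      using fin psubset_card_mono by blast
    moreover have "h holomorphic_on UNIV"
      unfolding h_def by (intro holomorphic_intros g)
    moreover have "h 0 \<noteq> 0" using fh[of 0] less.prems(2) by auto
    ultimately obtain p k where pk: "p holomorphic_on UNIV" "k holomorphic_on UNIV"
      "\<And>z. h z = p z * k z" "p 0 = 1" "\<And>z. norm z = 3 * R \<Longrightarrow> norm (p z) \<ge> 1"
      "\<And>z. z \<in> cball 0 R \<Longrightarrow> k z \<noteq> 0"
      using less.hyps[of h] by blast
    define q where "q = (\<lambda>z. (1 - z / a) ^ n * p z)"
    have "norm (q z) \<ge> 1" if z: "norm z = 3 * R" for z
    proof -
      have "norm (z / a) \<ge> 3" using z a a0 by (simp add: norm_divide field_simps)
      then have "norm (1 - z / a) \<ge> 1"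
        using norm_triangle_ineq2[of "z / a" 1] by (simp add: norm_minus_commute)
      then have "1 * 1 \<le> norm (1 - z / a) ^ n * norm (p z)"
        by (intro mult_mono one_le_power pk(5) z) auto
      then show ?thesis by (simp add: q_def norm_mult norm_power)
    qed
    moreover have "q holomorphic_on UNIV"
      unfolding q_def by (intro holomorphic_intros pk) (use a0 in auto)
    moreover have "q 0 = 1" using pk(4) by (simp add: q_def)
    moreover have "f z = q z * k z" for z by (simp add: fh q_def pk(3))
    ultimately show ?thesis using pk(2,6) by blast
  qed
qed

section \<open>Growth of the exponent in a zero-free quotient\<close>

text \<open>A form of finite order with natural exponents. The base \<open>1 + norm z\<close> is at
  least 1, so such bounds are monotone in \<open>N\<close> and easily combined.\<close>

definition exp_growth :: "(complex \<Rightarrow> complex) \<Rightarrow> bool" where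
  "exp_growth f \<longleftrightarrow> (\<exists>C N. \<forall>z. norm (f z) \<le> exp (C * (1 + norm z) ^ N))"

text \<open>Also used with \<open>g = f\<close>, where it supplies a nonnegative constant.\<close>

lemma exp_growth_common:
  assumes "exp_growth f" "exp_growth g"
  obtains C N where "C \<ge> 0" "\<And>z. norm (f z) \<le> exp (C * (1 + norm z) ^ N)"
    "\<And>z. norm (g z) \<le> exp (C * (1 + norm z) ^ N)"
proof -
  obtain C1 N1 C2 N2 where
    1: "\<And>z. norm (f z) \<le> exp (C1 * (1 + norm z) ^ N1)" and
    2: "\<And>z. norm (g z) \<le> exp (C2 * (1 + norm z) ^ N2)"
    using assms unfolding exp_growth_def by blast
  define C where "C = max 0 (max C1 C2)"
  define N where "N = max N1 N2"
  have "C1 * (1 + norm z) ^ N1 \<le> C * (1 + norm z) ^ N"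
    "C2 * (1 + norm z) ^ N2 \<le> C * (1 + norm z) ^ N" for z :: complex
    by (intro mult_mono power_increasing; simp add: C_def N_def)+
  then have "norm (f z) \<le> exp (C * (1 + norm z) ^ N)"
    "norm (g z) \<le> exp (C * (1 + norm z) ^ N)" for z
    using 1[of z] 2[of z] by (meson exp_le_cancel_iff order_trans)+
  then show ?thesis by (rule that[of C N, rotated]) (simp add: C_def)
qed

text \<open>The functions \<open>f\<close> and \<open>exp P * f\<close> are divided by the same \<open>p\<close>; the logarithm of the zero-free \<open>f / p\<close>
  is bounded below by Borel--Caratheodory.\<close>

lemma Re_log_quotient_bound:
  assumes f: "f holomorphic_on UNIV" and f0: "f 0 \<noteq> 0" and P: "P holomorphic_on UNIV"
    and R: "R > 0" and z: "norm z \<le> R / 2"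
    and B: "\<And>w. norm w = 3 * R \<Longrightarrow> norm (f w) \<le> exp B"
      "\<And>w. norm w = 3 * R \<Longrightarrow> norm (exp (P w) * f w) \<le> exp B"
  shows "Re (P z) \<le> 3 * B - 3 * ln (norm (f 0))"
proof -
  obtain p g where p: "p holomorphic_on UNIV" "g holomorphic_on UNIV"
      "\<And>z. f z = p z * g z" "p 0 = 1" "\<And>z. norm z = 3 * R \<Longrightarrow> norm (p z) \<ge> 1"
      "\<And>z. z \<in> cball 0 R \<Longrightarrow> g z \<noteq> 0"
    using entire_divide_zeros[OF f f0 R] by blast
  have max_mod: "norm (h w) \<le> exp B"
    if h: "h holomorphic_on UNIV" "\<And>w. norm w = 3 * R \<Longrightarrow> norm (p w * h w) \<le> exp B"
      and w: "norm w \<le> 3 * R" for h w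
  proof (rule maximum_modulus_frontier[of h "cball 0 (3 * R)"])
    fix x :: complex assume "x \<in> frontier (cball 0 (3 * R))"
    then have x: "norm x = 3 * R" using R by (simp add: frontier_cball)
    then have "1 * norm (h x) \<le> norm (p x) * norm (h x)"
      by (intro mult_right_mono p) auto
    also have "\<dots> \<le> exp B" using h(2)[OF x] by (simp add: norm_mult)
    finally show "norm (h x) \<le> exp B" by simp
  qed (use w h(1) in \<open>auto intro: holomorphic_on_subset holomorphic_on_imp_continuous_on\<close>)
  have g_le: "norm (g w) \<le> exp B" if "norm w \<le> 3 * R" for w
    by (rule max_mod[OF p(2) _ that]) (use B p(3) in auto)
  have Eg_le: "norm (exp (P w) * g w) \<le> exp B" if "norm w \<le> 3 * R" for w
    by (rule max_mod[of "\<lambda>w. exp (P w) * g w", OF _ _ that])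
       (use B(2) p(3) in \<open>auto intro!: holomorphic_intros p P simp: mult.left_commute\<close>)
  \<comment> \<open>The cofactor \<open>g\<close> has no zeros in the disc, which is simply
    connected, so it has a logarithm there.\<close>
  obtain v where v: "v holomorphic_on ball 0 R" "\<And>w. w \<in> ball 0 R \<Longrightarrow> g w = exp (v w)"
    by (rule contractible_imp_holomorphic_log[of g "ball 0 R"])
       (use p in \<open>auto intro: holomorphic_on_subset convex_imp_contractible\<close>)
  have "Re (v w) \<le> B" if "w \<in> ball 0 R" for w
    using g_le[of w] v(2)[OF that] that R by simp
  from Borel_Caratheodory_half[OF v(1) R this z]
  have "norm (v z - v 0) \<le> 2 * (B - Re (v 0))" .
  then have "Re (v 0) - Re (v z) \<le> 2 * (B - Re (v 0))"
    using abs_Re_le_cmod[of "v z - v 0"] by simp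
  moreover have "Re (v 0) = ln (norm (f 0))"
    using v(2)[of 0] R p(3)[of 0] p(4) by simp
  \<comment> \<open>\<open>P + v\<close> is a logarithm of \<open>exp P * g\<close>. Together with
    the lower bound \<open>3 * Re (v 0) - 2 * B\<close> for \<open>Re (v z)\<close> this yields the
    claim.\<close>
  moreover have "Re (P z) + Re (v z) \<le> B"
    using Eg_le[of z] v(2)[of z] z R by (simp add: exp_add[symmetric])
  ultimately show ?thesis by simp
qed

text \<open>First \<open>Re P\<close> is bounded above by comparing the two growth bounds;
  Borel--Caratheodory then turns this one-sided bound into a bound for
  \<open>norm (P z)\<close>.\<close>

lemma log_quotient_growth_aux:
  assumes f: "f holomorphic_on UNIV" and f0: "f 0 \<noteq> 0" and P: "P holomorphic_on UNIV"
    and gr: "exp_growth f" "exp_growth (\<lambda>z. exp (P z) * f z)"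
  shows "\<exists>C N. \<forall>z. norm (P z) \<le> C * (1 + norm z) ^ N"
proof -
  obtain C N where C: "C \<ge> 0" "\<And>z. norm (f z) \<le> exp (C * (1 + norm z) ^ N)"
    "\<And>z. norm (exp (P z) * f z) \<le> exp (C * (1 + norm z) ^ N)"
    using exp_growth_common[OF gr] by metis
  define K where "K = 3 * C * 6 ^ N + 3 * \<bar>ln (norm (f 0))\<bar>"
  have ge1: "1 \<le> (1 + norm z) ^ N" for z :: complex by (intro one_le_power) auto
  have K0: "K \<ge> 0" using C by (simp add: K_def)
  have Re_P: "Re (P z) \<le> K * (1 + norm z) ^ N" for z
  proof -
    \<comment> \<open>This makes \<open>norm z \<le> R / 2\<close>, while \<open>1 + 3 * R\<close>
      stays below \<open>6 * (1 + norm z)\<close>; hence the factor \<open>6 ^ N\<close> in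
      \<open>K\<close>.\<close>
    define R where "R = 2 * norm z + 1"
    have "Re (P z) \<le> 3 * (C * (1 + 3 * R) ^ N) - 3 * ln (norm (f 0))"
    proof (rule Re_log_quotient_bound[OF f f0 P])
      show "norm (f w) \<le> exp (C * (1 + 3 * R) ^ N)"
        "norm (exp (P w) * f w) \<le> exp (C * (1 + 3 * R) ^ N)" if "norm w = 3 * R" for w
        using C(2,3)[of w] that by simp_all
    qed (auto simp: R_def add_nonneg_pos)
    also have "C * (1 + 3 * R) ^ N \<le> C * (6 * (1 + norm z)) ^ N"
      using C(1) by (intro mult_left_mono power_mono) (auto simp: R_def)
    also have "3 * (C * (6 * (1 + norm z)) ^ N) - 3 * ln (norm (f 0))
        \<le> 3 * C * 6 ^ N * (1 + norm z) ^ N + 3 * \<bar>ln (norm (f 0))\<bar> * (1 + norm z) ^ N"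
    proof -
      have "3 * (C * (6 * (1 + norm z)) ^ N) = 3 * C * 6 ^ N * (1 + norm z) ^ N"
        by (simp only: power_mult_distrib mult.assoc)
      moreover have "3 * \<bar>ln (norm (f 0))\<bar> * 1 \<le> 3 * \<bar>ln (norm (f 0))\<bar> * (1 + norm z) ^ N"
        by (intro mult_left_mono ge1) auto
      ultimately show ?thesis by linarith
    qed
    also have "\<dots> = K * (1 + norm z) ^ N" by (simp add: K_def distrib_right)
    finally show ?thesis by simp
  qed
  have "norm (P z) \<le> (2 * K * 2 ^ N + 3 * norm (P 0)) * (1 + norm z) ^ N" for z
  proof -
    define R where "R = 2 * norm z + 1"
    have "norm (P z - P 0) \<le> 2 * (K * (1 + R) ^ N - Re (P 0))"
    proof (rule Borel_Caratheodory_half[of P R])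
      fix w :: complex assume "w \<in> ball 0 R"
      then have "K * (1 + norm w) ^ N \<le> K * (1 + R) ^ N"
        using K0 by (intro mult_left_mono power_mono) auto
      then show "Re (P w) \<le> K * (1 + R) ^ N" using Re_P[of w] by simp
    qed (auto simp: R_def add_nonneg_pos intro: holomorphic_on_subset[OF P])
    also have "(1 + R) ^ N = 2 ^ N * (1 + norm z) ^ N"
      by (simp add: R_def power_mult_distrib[symmetric])
    finally have "norm (P z - P 0) \<le> 2 * K * 2 ^ N * (1 + norm z) ^ N - 2 * Re (P 0)"
      by simp
    moreover have "norm (P z) \<le> norm (P z - P 0) + norm (P 0)"
      using norm_triangle_ineq[of "P z - P 0" "P 0"] by simp
    moreover have "- Re (P 0) \<le> norm (P 0)" using abs_Re_le_cmod[of "P 0"] by linarith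
    moreover have "norm (P 0) * 1 \<le> norm (P 0) * (1 + norm z) ^ N"
      by (intro mult_left_mono ge1) auto
    ultimately show ?thesis by (simp add: distrib_right)
  qed
  then show ?thesis by blast
qed

lemma polynomial_growth_shift:
  fixes f :: "complex \<Rightarrow> complex"
  assumes "\<And>z. norm (f (c + z)) \<le> C * (1 + norm z) ^ N" "C \<ge> 0"
  shows "norm (f z) \<le> C * (1 + norm c) ^ N * (1 + norm z) ^ N"
proof -
  have "(1 + norm c) * (1 + norm z) = 1 + norm c + norm z + norm c * norm z"
    by (simp add: algebra_simps)
  then have "1 + norm (z - c) \<le> (1 + norm c) * (1 + norm z)"
    using norm_triangle_ineq4[of z c] mult_nonneg_nonneg[OF norm_ge_zero[of c] norm_ge_zero[of z]]
    by linarith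
  then have "(1 + norm (z - c)) ^ N \<le> ((1 + norm c) * (1 + norm z)) ^ N"
    by (intro power_mono) auto
  then have "C * (1 + norm (z - c)) ^ N \<le> C * ((1 + norm c) * (1 + norm z)) ^ N"
    using assms(2) by (intro mult_left_mono)
  then show ?thesis using assms(1)[of "z - c"] by (simp add: power_mult_distrib mult.assoc)
qed

lemma exp_growth_shift:
  assumes "exp_growth f"
  shows "exp_growth (\<lambda>z. f (c + z))"
proof -
  obtain C N where C: "C \<ge> 0" "\<And>z. norm (f z) \<le> exp (C * (1 + norm z) ^ N)"
    using exp_growth_common[OF assms assms] by metis
  have "norm (f (c + z)) \<le> exp (C * (1 + norm c) ^ N * (1 + norm z) ^ N)" for z
  proof -
    have "(1 + norm c) * (1 + norm z) = 1 + norm c + norm z + norm c * norm z"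
      by (simp add: algebra_simps)
    then have "1 + norm (c + z) \<le> (1 + norm c) * (1 + norm z)"
      using norm_triangle_ineq[of c z] mult_nonneg_nonneg[OF norm_ge_zero[of c] norm_ge_zero[of z]]
      by linarith
    then have "(1 + norm (c + z)) ^ N \<le> ((1 + norm c) * (1 + norm z)) ^ N"
      by (intro power_mono) auto
    then have "C * (1 + norm (c + z)) ^ N \<le> C * ((1 + norm c) * (1 + norm z)) ^ N"
      using C(1) by (intro mult_left_mono)
    then have "exp (C * (1 + norm (c + z)) ^ N) \<le> exp (C * (1 + norm c) ^ N * (1 + norm z) ^ N)"
      by (simp add: power_mult_distrib mult.assoc)
    with C(2)[of "c + z"] show ?thesis by linarith
  qed
  then show ?thesis unfolding exp_growth_def by blast
qed

text \<open>Translation moves the point \<open>c\<close> to the origin. This is needed because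
  \<open>CdB_B\<close> may vanish at 0, but never at the points of \<open>T\<close>.\<close>

lemma log_quotient_growth:
  assumes f: "f holomorphic_on UNIV" and fc: "f c \<noteq> 0" and P: "P holomorphic_on UNIV"
    and gr: "exp_growth f" "exp_growth (\<lambda>z. exp (P z) * f z)"
  shows "\<exists>C N. \<forall>z. norm (P z) \<le> C * (1 + norm z) ^ N"
proof -
  have shift: "(\<lambda>z. h (c + z)) holomorphic_on UNIV" if "h holomorphic_on UNIV" for h
  proof -
    have "(h \<circ> (\<lambda>z. c + z)) holomorphic_on UNIV"
      by (rule holomorphic_on_compose_gen[OF _ that]) (auto intro!: holomorphic_intros)
    then show ?thesis by (simp add: o_def)
  qed
  obtain C N where C: "\<And>z. norm (P (c + z)) \<le> C * (1 + norm z) ^ N"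
    using log_quotient_growth_aux[of "\<lambda>z. f (c + z)" "\<lambda>z. P (c + z)"] shift[OF f] shift[OF P] fc
      exp_growth_shift[OF gr(1), of c] exp_growth_shift[OF gr(2), of c] by auto
  have "norm (P c) \<le> C" using C[of 0] by simp
  then have "C \<ge> 0" using norm_ge_zero[of "P c"] by linarith
  then have "norm (P z) \<le> C * (1 + norm c) ^ N * (1 + norm z) ^ N" for z
    by (intro polynomial_growth_shift C)
  then show ?thesis by blast
qed

subsection \<open>The functions \<open>B\<^sub>\<gamma>\<close>\<close>

lemma holomorphic_bounded_on_cball:
  assumes "f holomorphic_on UNIV"
  shows "\<exists>M. \<forall>w. norm w \<le> R \<longrightarrow> norm (f w) \<le> M"
proof -
  have "compact (f ` cball 0 R)"
    by (intro compact_continuous_image holomorphic_on_imp_continuous_on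
        holomorphic_on_subset[OF assms]) auto
  then have "bounded (f ` cball 0 R)" by (rule compact_imp_bounded)
  then obtain M where "\<forall>y \<in> f ` cball 0 R. norm y \<le> M"
    unfolding bounded_iff by blast
  then show ?thesis by (intro exI[of _ M]) auto
qed

text \<open>\<open>powr\<close> is monotone in the exponent only for bases at least 1, so the unit
  disc is treated separately, by compactness.\<close>

lemma finite_order_imp_exp_growth:
  assumes "f holomorphic_on UNIV" "finite_order f"
  shows "exp_growth f"
proof -
  obtain \<rho> C where C: "\<And>z. norm (f z) \<le> C * exp (norm z powr \<rho>)"
    using assms(2) unfolding finite_order_def by blast
  obtain K where K: "\<And>z. norm z \<le> 1 \<Longrightarrow> norm (f z) \<le> K"
    using holomorphic_bounded_on_cball[OF assms(1), of 1] by blast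
  \<comment> \<open>A negative ceiling is sent to 0, so \<open>real N\<close> is at least \<rho> in
    every case.\<close>
  define N where "N = nat \<lceil>\<rho>\<rceil>"
  have "norm (f z) \<le> exp ((\<bar>C\<bar> + \<bar>K\<bar> + 1) * (1 + norm z) ^ N)" for z
  proof -
    have ge1: "1 \<le> (1 + norm z) ^ N" by (intro one_le_power) auto
    have "\<bar>C\<bar> + \<bar>K\<bar> + (1 + norm z) ^ N \<le> (\<bar>C\<bar> + \<bar>K\<bar> + 1) * (1 + norm z) ^ N"
      using mult_left_mono[OF ge1, of "\<bar>C\<bar> + \<bar>K\<bar>"] by (simp add: distrib_right)
    moreover have "norm (f z) \<le> exp (\<bar>C\<bar> + \<bar>K\<bar> + (1 + norm z) ^ N)"
    proof (cases "norm z \<le> 1")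
      case True
      have "norm (f z) \<le> 1 + \<bar>K\<bar>" using K[OF True] by linarith
      also have "\<dots> \<le> exp \<bar>K\<bar>" by (rule exp_ge_add_one_self)
      also have "\<dots> \<le> exp (\<bar>C\<bar> + \<bar>K\<bar> + (1 + norm z) ^ N)" using ge1 by simp
      finally show ?thesis .
    next
      case False
      have "norm z powr \<rho> \<le> norm z powr real N"
        using False by (intro powr_mono) (auto simp: N_def real_nat_ceiling_ge)
      also have "\<dots> = norm z ^ N" using False by (intro powr_realpow) auto
      also have "\<dots> \<le> (1 + norm z) ^ N" by (intro power_mono) auto
      finally have *: "norm z powr \<rho> \<le> (1 + norm z) ^ N" .
      have "C \<le> 1 + \<bar>C\<bar>" by simp
      also have "\<dots> \<le> exp \<bar>C\<bar>" by (rule exp_ge_add_one_self)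
      finally have "C * exp (norm z powr \<rho>) \<le> exp \<bar>C\<bar> * exp ((1 + norm z) ^ N)"
        using * by (intro mult_mono) auto
      also have "\<dots> \<le> exp (\<bar>C\<bar> + \<bar>K\<bar> + (1 + norm z) ^ N)" by (simp add: exp_add[symmetric])
      finally show ?thesis using C[of z] by linarith
    qed
    ultimately show ?thesis by (meson exp_le_cancel_iff order_trans)
  qed
  then show ?thesis unfolding exp_growth_def by blast
qed

text \<open>Equal multiplicities make the singularities of \<open>g / f\<close> removable with
  nonzero values. The quotient is therefore entire and zero-free, and has a logarithm on the
  plane.\<close>

lemma same_zeros_imp_exp_quotient:
  assumes f: "f holomorphic_on UNIV" and g: "g holomorphic_on UNIV"
    and same: "same_zeros_mult f g" and fb: "f b \<noteq> 0"
  shows "\<exists>P. P holomorphic_on UNIV \<and> (\<forall>z. g z = exp (P z) * f z)"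
proof -
  \<comment> \<open>At a common zero the value is the quotient of the leading Taylor
    coefficients.\<close>
  define E where "E = (\<lambda>z. if f z = 0 then zor_poly g z z / zor_poly f z z else g z / f z)"
  have zeros: "f z = 0 \<longleftrightarrow> g z = 0" "f z = 0 \<Longrightarrow> zorder f z = zorder g z" for z
    using same by (auto simp: same_zeros_mult_def)
  have "\<exists>e>0. E holomorphic_on ball a e \<and> E a \<noteq> 0" for a
  proof -
    note ex = zorder_exist_zero[OF _ open_UNIV connected_UNIV UNIV_I, of _ a]
    have of0: "if f a = 0 then 0 < zorder f a else zorder f a = 0"
      and og0: "if g a = 0 then 0 < zorder g a else zorder g a = 0"
      using ex[OF f] ex[OF g] fb zeros(1) by blast+
    \<comment> \<open>The orders agree also where neither function vanishes, both being 0, so one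
      exponent \<open>n\<close> serves at every point.\<close>
    then have ord: "zorder g a = zorder f a"
      using zeros[of a] by (auto split: if_splits)
    define n where "n = nat (zorder f a)"
    obtain r where r: "r > 0" "zor_poly f a holomorphic_on cball a r"
      "\<And>w. w \<in> cball a r \<Longrightarrow> f w = zor_poly f a w * (w - a) ^ n \<and> zor_poly f a w \<noteq> 0"
      using ex[OF f] fb unfolding n_def by blast
    obtain s where s: "s > 0" "zor_poly g a holomorphic_on cball a s"
      "\<And>w. w \<in> cball a s \<Longrightarrow> g w = zor_poly g a w * (w - a) ^ n \<and> zor_poly g a w \<noteq> 0"
      using ex[OF g] fb zeros(1) unfolding n_def ord[symmetric] by blast
    define e where "e = min r s"
    have e: "e > 0" using r s by (simp add: e_def)
    have E_eq: "E w = zor_poly g a w / zor_poly f a w" if "w \<in> ball a e" for w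
    proof -
      have w: "w \<in> cball a r" "w \<in> cball a s" using that by (auto simp: e_def)
      show ?thesis
      proof (cases "f w = 0")
        case True
        then have "w = a" using r(3)[OF w(1)] by auto
        with True show ?thesis by (simp add: E_def)
      next
        case False
        then have "(w - a) ^ n \<noteq> 0" using r(3)[OF w(1)] by auto
        with False show ?thesis using r(3)[OF w(1)] s(3)[OF w(2)] by (simp add: E_def)
      qed
    qed
    have "(\<lambda>w. zor_poly g a w / zor_poly f a w) holomorphic_on ball a e"
      using r s by (intro holomorphic_intros) (auto simp: e_def intro: holomorphic_on_subset)
    then have "E holomorphic_on ball a e"
      by (rule holomorphic_transform) (simp add: E_eq)
    moreover have "E a \<noteq> 0" using E_eq[of a] e r(1) r(3)[of a] s(1) s(3)[of a] by auto
    ultimately show ?thesis using e by blast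
  qed
  then have "E analytic_on UNIV" and E0: "\<And>z. E z \<noteq> 0"
    unfolding analytic_on_def by blast+
  then have "E holomorphic_on UNIV" by (simp add: analytic_imp_holomorphic)
  then obtain P where P: "P holomorphic_on UNIV" "\<And>z. E z = exp (P z)"
    using contractible_imp_holomorphic_log[of E UNIV] E0 by (metis UNIV_I contractible_UNIV)
  have "g z = E z * f z" for z using zeros(1)[of z] by (simp add: E_def)
  with P show ?thesis by auto
qed

section \<open>The series of entire functions that represents \<open>CdB_B\<close>\<close>

text \<open>When \<open>A t = 0\<close> the value at \<open>t\<close> is the limit of the quotient,
  so the function is entire and \<open>CdB_B\<close> becomes a series without case
  distinction.\<close>

definition divided_zero :: "(complex \<Rightarrow> complex) \<Rightarrow> complex \<Rightarrow> complex \<Rightarrow> complex" where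
  "divided_zero A t z = (if z = t then - deriv A t else A z / (t - z))"

lemma divided_zero_holomorphic:
  assumes A: "A holomorphic_on UNIV" and "A t = 0"
  shows "divided_zero A t holomorphic_on UNIV"
proof (rule pole_theorem_0)
  show "(\<lambda>z. - A z) holomorphic_on UNIV" by (intro holomorphic_intros A)
  show "- A z = (z - t) * divided_zero A t z" if "z \<in> UNIV - {t}" for z
    using that by (simp add: divided_zero_def divide_simps) (simp add: algebra_simps)
  show "divided_zero A t t = deriv (\<lambda>z. - A z) t"
    using A by (simp add: divided_zero_def holomorphic_on_imp_differentiable_at)
qed (use assms in auto)

text \<open>Near \<open>t\<close> the bound comes from the maximum principle on the unit circle around \<open>t\<close>.\<close>

lemma norm_divided_zero_le:
  assumes A: "A holomorphic_on UNIV" and "A t = 0"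
    and M: "\<And>w. norm w \<le> norm z + 2 \<Longrightarrow> norm (A w) \<le> M"
  shows "norm (divided_zero A t z) \<le> M * (2 * (norm z + 1)) / (norm t + 1)"
proof -
  have M0: "M \<ge> 0" using M[of z] norm_ge_zero[of "A z"] by linarith
  have t1: "norm t + 1 > 0" by (simp add: add_nonneg_pos)
  show ?thesis
  proof (cases "norm (z - t) \<ge> 1")
    case True
    have "norm t + 1 \<le> norm z + norm (z - t) + 1"
      using norm_triangle_ineq4[of z "z - t"] by simp
    also have "\<dots> \<le> norm z * norm (z - t) + norm (z - t) + norm (z - t)"
      using True mult_left_mono[OF True, of "norm z"] by simp
    also have "\<dots> \<le> 2 * (norm z + 1) * norm (z - t)"
      by (simp add: algebra_simps)
    finally have "norm (A z) * (norm t + 1) \<le> M * (2 * (norm z + 1) * norm (z - t))"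
      using M0 M[of z] by (intro mult_mono) auto
    moreover have "norm (divided_zero A t z) = norm (A z) / norm (z - t)"
      using True by (auto simp: divided_zero_def norm_divide norm_minus_commute)
    moreover have "norm (z - t) > 0" using True by linarith
    ultimately show ?thesis using t1 by (simp add: pos_le_divide_eq divide_le_eq mult_ac)
  next
    case False
    have "norm (divided_zero A t z) \<le> M"
    proof (rule maximum_modulus_frontier[of "divided_zero A t" "cball t 1"])
      fix w assume "w \<in> frontier (cball t 1)"
      then have w: "norm (t - w) = 1" by (simp add: dist_norm)
      \<comment> \<open>The unit circle around \<open>t\<close> lies within distance 2 of
        \<open>z\<close>; this explains the radius in the hypothesis on \<open>M\<close>.\<close>
      have "norm w \<le> norm z + 2"
        using norm_triangle_ineq4[of t "t - w"] norm_triangle_ineq4[of z "z - t"] w False by simp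
      moreover have "w \<noteq> t" using w by auto
      ultimately show "norm (divided_zero A t w) \<le> M"
        using M[of w] w by (simp add: divided_zero_def norm_divide)
    qed (use False divided_zero_holomorphic[OF assms(1,2)] in
        \<open>auto intro: holomorphic_on_subset holomorphic_on_imp_continuous_on simp: dist_norm norm_minus_commute\<close>)
    moreover have "norm t + 1 \<le> 2 * (norm z + 1)"
    proof -
      have "norm t \<le> norm z + norm (z - t)"
        using norm_triangle_ineq4[of z "z - t"] by simp
      also have "\<dots> \<le> norm z + 1" using False by simp
      finally show ?thesis using norm_ge_zero[of z] by (simp del: norm_ge_zero)
    qed
    then have "M * (norm t + 1) \<le> M * (2 * (norm z + 1))"
      using M0 by (intro mult_left_mono)
    ultimately show ?thesis using t1 by (simp add: pos_le_divide_eq)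
      (meson mult_right_mono order_trans less_imp_le)
  qed
qed

lemma CdB_dataD:
  assumes "CdB_data T mu A"
  shows "inj T" "filterlim (\<lambda>n. norm (T n)) at_top sequentially" "\<And>n. mu n > 0"
    "A holomorphic_on UNIV" "\<And>z. A z = 0 \<longleftrightarrow> z \<in> range T" "\<And>n. deriv A (T n) \<noteq> 0"
  using assms unfolding CdB_data_def by blast+

context
  fixes T mu A
  assumes data: "CdB_data T mu A" and conv: "CdB_convergence_class T mu"
begin

lemma summable_convergence_class: "summable (\<lambda>n. mu n / (norm (T n) + 1))"
  using conv by (simp add: CdB_convergence_class_def)

text \<open>The convergence class enters here: the weights on the right are summable, and the factor
  in front does not depend on \<open>n\<close>.\<close>

lemma norm_CdB_term_le:
  assumes M: "\<And>w. norm w \<le> norm z + 2 \<Longrightarrow> norm (A w) \<le> M"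
  shows "norm (of_real (mu n) * divided_zero A (T n) z)
    \<le> M * (2 * (norm z + 1)) * (mu n / (norm (T n) + 1))"
proof -
  have "norm (divided_zero A (T n) z) \<le> M * (2 * (norm z + 1)) / (norm (T n) + 1)"
    by (rule norm_divided_zero_le) (use CdB_dataD[OF data] M in auto)
  then have "mu n * norm (divided_zero A (T n) z) \<le> mu n * (M * (2 * (norm z + 1)) / (norm (T n) + 1))"
    using CdB_dataD(3)[OF data, of n] by (intro mult_left_mono) auto
  then show ?thesis
    using CdB_dataD(3)[OF data, of n] by (simp add: norm_mult mult_ac)
qed

lemma summable_norm_CdB_term: "summable (\<lambda>n. norm (of_real (mu n) * divided_zero A (T n) z))"
proof -
  obtain M where "\<And>w. norm w \<le> norm z + 2 \<Longrightarrow> norm (A w) \<le> M"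
    using holomorphic_bounded_on_cball[OF CdB_dataD(4)[OF data]] by blast
  from norm_CdB_term_le[OF this] show ?thesis
    by (intro summable_comparison_test'[OF summable_mult[OF summable_convergence_class]]) auto
qed

text \<open>At \<open>T m\<close> all terms but the one with index \<open>m\<close> vanish;
  elsewhere \<open>A z\<close> factors out. The formula also shows that \<open>CdB_B\<close> is
  affine in \<gamma> with slope \<open>A z\<close>, from which \<open>A\<close> is recovered
  later.\<close>

lemma CdB_B_eq_suminf:
  "CdB_B T mu A \<gamma> z = \<gamma> * A z + (\<Sum>n. of_real (mu n) * divided_zero A (T n) z)"
proof (cases "z \<in> range T")
  case True
  then obtain m where m: "z = T m" by blast
  have inj: "inj T" using CdB_dataD[OF data] by blast
  have Az: "A z = 0" using CdB_dataD(5)[OF data] True by blast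
  have "(\<Sum>n. of_real (mu n) * divided_zero A (T n) z)
      = (\<Sum>n\<in>{m}. of_real (mu n) * divided_zero A (T n) z)"
    by (rule suminf_finite) (use Az inj in \<open>auto simp: divided_zero_def m inj_eq\<close>)
  then show ?thesis
    using True Az inj by (simp add: CdB_B_def m divided_zero_def)
next
  case False
  then have Az: "A z \<noteq> 0" using CdB_dataD(5)[OF data] by blast
  have eq: "of_real (mu n) * divided_zero A (T n) z = A z * (of_real (mu n) / (T n - z))" for n
    using False by (auto simp: divided_zero_def)
  have "summable (\<lambda>n. A z * (of_real (mu n) / (T n - z)))"
    using summable_norm_cancel[OF summable_norm_CdB_term[of z]] unfolding eq .
  then have "summable (\<lambda>n. of_real (mu n) / (T n - z))"
    using Az by (rule summable_mult_D)
  then show ?thesis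
    using False by (simp add: CdB_B_def eq suminf_mult[symmetric] algebra_simps)
qed

lemma CdB_B_holomorphic: "CdB_B T mu A \<gamma> holomorphic_on UNIV"
proof -
  have A: "A holomorphic_on UNIV" using CdB_dataD[OF data] by blast
  have "(\<lambda>z. \<Sum>n. of_real (mu n) * divided_zero A (T n) z) holomorphic_on UNIV"
  proof (rule holomorphic_uniform_sequence[OF open_UNIV])
    show "(\<lambda>z. \<Sum>i<n. of_real (mu i) * divided_zero A (T i) z) holomorphic_on UNIV" for n
      by (intro holomorphic_intros divided_zero_holomorphic A) (use CdB_dataD[OF data] in auto)
  next
    fix x :: complex
    \<comment> \<open>The summand 1 is the radius of the disc of uniform convergence, the summand 2
      the margin required by \<open>norm_CdB_term_le\<close>.\<close>
    obtain M where M: "\<And>w. norm w \<le> norm x + 1 + 2 \<Longrightarrow> norm (A w) \<le> M"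
      using holomorphic_bounded_on_cball[OF CdB_dataD(4)[OF data]] by blast
    have M0: "M \<ge> 0" using M[of 0] norm_ge_zero[of "A 0"] norm_ge_zero[of x] by (smt (verit) norm_zero)
    have "uniform_limit (cball x 1) (\<lambda>n z. \<Sum>i<n. of_real (mu i) * divided_zero A (T i) z)
        (\<lambda>z. \<Sum>n. of_real (mu n) * divided_zero A (T n) z) sequentially"
    proof (rule Weierstrass_m_test)
      fix n z assume "z \<in> cball x 1"
      then have z: "norm z \<le> norm x + 1"
        using norm_triangle_ineq4[of x "x - z"] by (simp add: dist_norm)
      have "norm (of_real (mu n) * divided_zero A (T n) z)
          \<le> M * (2 * (norm z + 1)) * (mu n / (norm (T n) + 1))"
        using z M by (intro norm_CdB_term_le) auto
      also have "\<dots> \<le> M * (2 * (norm x + 1 + 1)) * (mu n / (norm (T n) + 1))"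
        using z M0 CdB_dataD(3)[OF data, of n]
        by (intro mult_right_mono mult_left_mono) (auto intro!: divide_nonneg_nonneg)
      finally show "norm (of_real (mu n) * divided_zero A (T n) z)
        \<le> M * (2 * (norm x + 1 + 1)) * (mu n / (norm (T n) + 1))" .
    qed (intro summable_mult summable_convergence_class)
    then show "\<exists>d>0. cball x d \<subseteq> UNIV \<and> uniform_limit (cball x d)
        (\<lambda>n z. \<Sum>i<n. of_real (mu i) * divided_zero A (T i) z)
        (\<lambda>z. \<Sum>n. of_real (mu n) * divided_zero A (T n) z) sequentially"
      by (intro exI[of _ 1]) auto
  qed
  then have "(\<lambda>z. \<gamma> * A z + (\<Sum>n. of_real (mu n) * divided_zero A (T n) z)) holomorphic_on UNIV"
    by (intro holomorphic_intros A)
  then show ?thesis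
    by (rule holomorphic_transform) (simp add: CdB_B_eq_suminf)
qed

lemma CdB_B_exp_growth:
  assumes "exp_growth A"
  shows "exp_growth (CdB_B T mu A \<gamma>)"
proof -
  obtain C N where C: "C \<ge> 0" "\<And>z. norm (A z) \<le> exp (C * (1 + norm z) ^ N)"
    using exp_growth_common[OF assms assms] by metis
  define S where "S = (\<Sum>n. mu n / (norm (T n) + 1))"
  define K where "K = norm \<gamma> + 2 * S"
  have S0: "S \<ge> 0"
    unfolding S_def using CdB_dataD(3)[OF data]
    by (intro suminf_nonneg summable_convergence_class) (auto simp: less_imp_le)
  then have K0: "K \<ge> 0" by (simp add: K_def)
  have "norm (CdB_B T mu A \<gamma> z) \<le> exp ((C * 3 ^ N + K + 1) * (1 + norm z) ^ Suc N)" for z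
  proof -
    define M where "M = exp (C * (3 + norm z) ^ N)"
    have M: "norm (A w) \<le> M" if "norm w \<le> norm z + 2" for w
    proof -
      have "C * (1 + norm w) ^ N \<le> C * (3 + norm z) ^ N"
        using that C by (intro mult_left_mono power_mono) auto
      then show ?thesis using C(2)[of w] unfolding M_def by (meson exp_le_cancel_iff order_trans)
    qed
    have "norm (\<Sum>n. of_real (mu n) * divided_zero A (T n) z)
        \<le> (\<Sum>n. norm (of_real (mu n) * divided_zero A (T n) z))"
      by (rule summable_norm[OF summable_norm_CdB_term])
    also have "\<dots> \<le> (\<Sum>n. M * (2 * (norm z + 1)) * (mu n / (norm (T n) + 1)))"
      by (intro suminf_le norm_CdB_term_le summable_norm_CdB_term summable_mult
          summable_convergence_class M)
    also have "\<dots> = M * (2 * (norm z + 1)) * S"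
      unfolding S_def by (rule suminf_mult[OF summable_convergence_class])
    finally have *: "norm (\<Sum>n. of_real (mu n) * divided_zero A (T n) z) \<le> M * (2 * (norm z + 1)) * S" .
    have "norm (\<gamma> * A z) \<le> norm \<gamma> * M"
      using M[of z] by (simp add: norm_mult mult_left_mono)
    also have "\<dots> \<le> norm \<gamma> * M * (norm z + 1)"
      using mult_left_mono[of 1 "norm z + 1" "norm \<gamma> * M"] by (simp add: M_def)
    finally have "norm (CdB_B T mu A \<gamma> z) \<le> norm \<gamma> * M * (norm z + 1) + M * (2 * (norm z + 1)) * S"
      unfolding CdB_B_eq_suminf using * by (intro norm_triangle_mono)
    also have "\<dots> = M * K * (1 + norm z)" by (simp add: K_def algebra_simps)
    \<comment> \<open>The factors in front of the exponential are moved into its exponent.\<close>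
    also have "\<dots> \<le> M * exp K * exp (norm z)"
    proof (intro mult_mono)
      show "K \<le> exp K" using exp_ge_add_one_self[of K] by linarith
      show "1 + norm z \<le> exp (norm z)" by (rule exp_ge_add_one_self)
    qed (use K0 in \<open>auto simp: M_def\<close>)
    also have "\<dots> = exp (C * (3 + norm z) ^ N + K + norm z)"
      by (simp add: M_def exp_add)
    also have "C * (3 + norm z) ^ N + K + norm z \<le> (C * 3 ^ N + K + 1) * (1 + norm z) ^ Suc N"
    proof -
      have "C * (3 + norm z) ^ N \<le> C * (3 * (1 + norm z)) ^ N"
        using C by (intro mult_left_mono power_mono) auto
      also have "\<dots> = C * 3 ^ N * (1 + norm z) ^ N"
        by (simp only: power_mult_distrib mult.assoc)
      also have "\<dots> \<le> C * 3 ^ N * (1 + norm z) ^ Suc N"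
        using C(1) by (intro mult_left_mono power_increasing) auto
      finally have 1: "C * (3 + norm z) ^ N \<le> C * 3 ^ N * (1 + norm z) ^ Suc N" .
      have 2: "K * 1 \<le> K * (1 + norm z) ^ Suc N"
        using K0 by (intro mult_left_mono one_le_power) auto
      have "(1 + norm z) ^ 1 \<le> (1 + norm z) ^ Suc N" by (intro power_increasing) auto
      with 1 2 show ?thesis by (simp add: distrib_right del: power_Suc)
    qed
    finally show ?thesis by simp
  qed
  then show ?thesis unfolding exp_growth_def by blast
qed

end

subsection \<open>Cauchy transforms and polynomials in sectors\<close>

text \<open>Poles beyond \<open>4 * r\<close> are at distance at least
  \<open>(norm (T n) + 1) / 4\<close> from \<open>z\<close>, so they contribute at most four times a
  small tail. The mass of the nearer poles is \<open>o(r)\<close>: finitely many are fixed, and each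
  remaining one has mass at most \<open>5 * r\<close> times a tail term.\<close>

lemma convergence_class_transform_bound:
  fixes T :: "nat \<Rightarrow> complex" and mu :: "nat \<Rightarrow> real"
  assumes lim: "filterlim (\<lambda>n. norm (T n)) at_top sequentially"
    and mu: "\<And>n. mu n > 0" and conv: "CdB_convergence_class T mu" and \<epsilon>: "\<epsilon> > 0"
  shows "\<exists>R\<ge>1. \<forall>r\<ge>R. finite {n. norm (T n) \<le> 4 * r} \<and>
    (\<Sum>n | norm (T n) \<le> 4 * r. mu n) \<le> \<epsilon> * r \<and>
    (\<forall>z. norm z \<le> 2 * r \<longrightarrow> norm (\<Sum>n. of_real (mu n) / (T n - z)) \<le>
      (\<Sum>n | norm (T n) \<le> 4 * r. mu n / norm (z - T n)) + \<epsilon>)"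
proof -
  define a where "a = (\<lambda>n. mu n / (norm (T n) + 1))"
  have a: "summable a" using conv by (simp add: CdB_convergence_class_def a_def)
  have T1: "norm (T n) + 1 > 0" for n by (simp add: add_nonneg_pos)
  have a0: "a n \<ge> 0" for n using mu[of n] T1[of n] by (simp add: a_def)
  \<comment> \<open>The near mass is bounded by \<open>r * e + 5 * r * e\<close>, the far sum by
    \<open>4 * e\<close>.\<close>
  define e where "e = \<epsilon> / 6"
  have e: "e > 0" using \<epsilon> by (simp add: e_def)
  obtain m where m: "\<And>n. norm (sum a {m..<n}) < e"
    using a e unfolding summable_Cauchy by blast
  have tail: "sum a J \<le> e" if "finite J" "J \<subseteq> {m..}" for J
  proof -
    obtain k where "J \<subseteq> {..<k}" using finite_nat_iff_bounded \<open>finite J\<close> by blast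
    then have "sum a J \<le> sum a {m..<k}"
      using that a0 by (intro sum_mono2) auto
    then show ?thesis using m[of k] by simp
  qed
  \<comment> \<open>The first sum puts all indices below \<open>m\<close> into the near set, the
    second makes their mass at most \<open>r * e\<close>.\<close>
  define R where "R = 1 + (\<Sum>n<m. norm (T n)) + (\<Sum>n<m. mu n) / e"
  have nn: "(\<Sum>n<m. norm (T n)) \<ge> 0" "(\<Sum>n<m. mu n) / e \<ge> 0"
    using e by (auto intro!: sum_nonneg divide_nonneg_pos less_imp_le[OF mu])
  show ?thesis
  proof (intro exI[of _ R] conjI allI impI)
    show "R \<ge> 1" using nn by (simp add: R_def)
    fix r assume "r \<ge> R"
    then have r: "r \<ge> 1" "r \<ge> (\<Sum>n<m. norm (T n))" "r \<ge> (\<Sum>n<m. mu n) / e"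
      using nn by (simp_all add: R_def)
    define N where "N = {n. norm (T n) \<le> 4 * r}"
    obtain n0 where n0: "\<And>n. n \<ge> n0 \<Longrightarrow> norm (T n) > 4 * r"
      using lim unfolding filterlim_at_top_dense eventually_sequentially by blast
    have "N \<subseteq> {..<n0}" using n0 by (force simp: N_def not_le[symmetric])
    then have fin: "finite N" using finite_subset by blast
    then show "finite {n. norm (T n) \<le> 4 * r}" by (simp add: N_def)
    have far: "n \<ge> m" if "n \<notin> N" for n
    proof (rule ccontr)
      assume "\<not> n \<ge> m"
      then have "norm (T n) \<le> (\<Sum>n<m. norm (T n))" by (intro member_le_sum) auto
      then show False using that r by (simp add: N_def)
    qed
    have "sum mu N \<le> sum mu ({..<m} \<union> (N \<inter> {m..}))"
      using fin mu by (intro sum_mono2) (auto intro: less_imp_le)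
    also have "\<dots> = (\<Sum>n<m. mu n) + sum mu (N \<inter> {m..})"
      using fin by (intro sum.union_disjoint) auto
    also have "sum mu (N \<inter> {m..}) \<le> (\<Sum>n\<in>N \<inter> {m..}. (5 * r) * a n)"
    proof (intro sum_mono)
      fix n assume "n \<in> N \<inter> {m..}"
      then have "norm (T n) + 1 \<le> 5 * r" using r by (simp add: N_def)
      then have "mu n * (norm (T n) + 1) \<le> mu n * (5 * r)"
        using mu[of n] by (intro mult_left_mono) auto
      then show "mu n \<le> 5 * r * a n"
        using T1[of n] by (simp add: a_def pos_le_divide_eq mult_ac)
    qed
    also have "\<dots> = 5 * r * sum a (N \<inter> {m..})" by (simp add: sum_distrib_left)
    also have "\<dots> \<le> 5 * r * e" using r fin by (intro mult_left_mono tail) auto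
    also have "(\<Sum>n<m. mu n) + 5 * r * e \<le> \<epsilon> * r"
    proof -
      have "(\<Sum>n<m. mu n) \<le> r * e" using r(3) e by (simp add: pos_divide_le_eq)
      moreover have "r * e + 5 * r * e = \<epsilon> * r" by (simp add: e_def)
      ultimately show ?thesis by linarith
    qed
    finally show "(\<Sum>n | norm (T n) \<le> 4 * r. mu n) \<le> \<epsilon> * r" by (simp add: N_def)
    fix z :: complex assume z: "norm z \<le> 2 * r"
    define b where "b = (\<lambda>n. norm (of_real (mu n) / (T n - z)))"
    have b_alt: "b n = mu n / norm (z - T n)" for n
      using mu[of n] by (simp add: b_def norm_divide norm_minus_commute)
    have b_le: "b n \<le> 4 * a n" if "n \<notin> N" for n
    proof -
      have "norm (T n) > 4 * r" using that by (simp add: N_def)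
      moreover have "norm (T n) - norm z \<le> norm (z - T n)"
        using norm_triangle_ineq2[of "T n" z] by (simp add: norm_minus_commute)
      ultimately have "(norm (T n) + 1) / 4 \<le> norm (z - T n)" using z r(1) by simp
      then have "mu n / norm (z - T n) \<le> mu n / ((norm (T n) + 1) / 4)"
        using mu[of n] T1[of n] by (intro divide_left_mono mult_pos_pos) auto
      then show ?thesis by (simp add: b_alt a_def mult.commute)
    qed
    have b: "summable b"
    proof (rule summable_comparison_test)
      have "norm (b n) \<le> 4 * a n" if "n \<ge> n0" for n
        using b_le[of n] n0[OF that] by (simp add: N_def b_def)
      then show "\<exists>n0. \<forall>n\<ge>n0. norm (b n) \<le> 4 * a n" by blast
      show "summable (\<lambda>n. 4 * a n)" by (intro summable_mult a)
    qed
    have "norm (\<Sum>n. of_real (mu n) / (T n - z)) \<le> suminf b"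
      unfolding b_def by (rule summable_norm) (use b in \<open>simp add: b_def\<close>)
    also have "\<dots> \<le> sum b N + \<epsilon>"
    proof (rule suminf_le_const[OF b])
      fix k
      have "sum b {..<k} = sum b ({..<k} \<inter> N) + sum b ({..<k} - N)"
        by (rule sum.Int_Diff) simp
      also have "sum b ({..<k} \<inter> N) \<le> sum b N"
        using fin by (intro sum_mono2) (auto simp: b_def)
      also have "sum b ({..<k} - N) \<le> (\<Sum>n\<in>{..<k} - N. 4 * a n)"
        by (intro sum_mono b_le) auto
      also have "\<dots> = 4 * sum a ({..<k} - N)" by (simp add: sum_distrib_left)
      also have "\<dots> \<le> 4 * e" using far by (intro mult_left_mono tail) auto
      also have "\<dots> \<le> \<epsilon>" using \<epsilon> by (simp add: e_def)
      finally show "sum b {..<k} \<le> sum b N + \<epsilon>" by simp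
    qed
    finally show "norm (\<Sum>n. of_real (mu n) / (T n - z)) \<le>
      (\<Sum>n | norm (T n) \<le> 4 * r. mu n / norm (z - T n)) + \<epsilon>"
      by (simp add: N_def b_alt)
  qed
qed

text \<open>Averaging over a square of side \<open>\<delta> * r / 2\<close> with corner
  \<open>w\<close>: the near mass is \<open>o(r)\<close> and the side is proportional to
  \<open>r\<close>, so the mean of the near sums is small.\<close>

lemma exists_point_small_transforms:
  fixes T T' :: "nat \<Rightarrow> complex" and mu mu' :: "nat \<Rightarrow> real"
  assumes T: "filterlim (\<lambda>n. norm (T n)) at_top sequentially" "\<And>n. mu n > 0"
      "CdB_convergence_class T mu"
    and T': "filterlim (\<lambda>n. norm (T' n)) at_top sequentially" "\<And>n. mu' n > 0"
      "CdB_convergence_class T' mu'"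
    and \<epsilon>: "\<epsilon> > 0" and \<delta>: "0 < \<delta>" "\<delta> < 1"
  shows "\<exists>R. \<forall>r\<ge>R. \<forall>w. norm w = r \<longrightarrow>
    (\<exists>z. norm (z - w) \<le> \<delta> * r \<and> z \<notin> range T \<and> z \<notin> range T' \<and>
      norm (\<Sum>n. of_real (mu n) / (T n - z)) \<le> \<epsilon> \<and>
      norm (\<Sum>n. of_real (mu' n) / (T' n - z)) \<le> \<epsilon>)"
proof -
  \<comment> \<open>With this value the averaging bound is
    \<open>64 * \<eta> / \<delta> = \<epsilon> / 4\<close>, and \<eta> still fits into the other
    half of \<epsilon>.\<close>
  define \<eta> where "\<eta> = \<epsilon> * \<delta> / 256"
  have \<eta>: "\<eta> > 0" "\<eta> \<le> \<epsilon> / 2"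
    using \<epsilon> \<delta> mult_left_mono[of \<delta> 1 \<epsilon>] by (auto simp: \<eta>_def)
  obtain R1 where R1: "R1 \<ge> 1" "\<And>r. r \<ge> R1 \<Longrightarrow> finite {n. norm (T n) \<le> 4 * r} \<and>
    (\<Sum>n | norm (T n) \<le> 4 * r. mu n) \<le> \<eta> * r \<and>
    (\<forall>z. norm z \<le> 2 * r \<longrightarrow> norm (\<Sum>n. of_real (mu n) / (T n - z)) \<le>
      (\<Sum>n | norm (T n) \<le> 4 * r. mu n / norm (z - T n)) + \<eta>)"
    using convergence_class_transform_bound[OF T \<eta>(1)] by blast
  obtain R2 where R2: "R2 \<ge> 1" "\<And>r. r \<ge> R2 \<Longrightarrow> finite {n. norm (T' n) \<le> 4 * r} \<and>
    (\<Sum>n | norm (T' n) \<le> 4 * r. mu' n) \<le> \<eta> * r \<and>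
    (\<forall>z. norm z \<le> 2 * r \<longrightarrow> norm (\<Sum>n. of_real (mu' n) / (T' n - z)) \<le>
      (\<Sum>n | norm (T' n) \<le> 4 * r. mu' n / norm (z - T' n)) + \<eta>)"
    using convergence_class_transform_bound[OF T' \<eta>(1)] by blast
  show ?thesis
  proof (intro exI[of _ "max R1 R2"] allI impI)
    fix r w assume "max R1 R2 \<le> r" and w: "norm (w :: complex) = r"
    then have r: "r \<ge> R1" "r \<ge> R2" "r \<ge> 1" using R1(1) by auto
    note 1 = R1(2)[OF r(1)] and 2 = R2(2)[OF r(2)]
    define N where "N = {n. norm (T n) \<le> 4 * r}"
    define N' where "N' = {n. norm (T' n) \<le> 4 * r}"
    have fin: "finite N" "finite N'" using 1 2 by (simp_all add: N_def N'_def)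
    \<comment> \<open>Both families are merged over a sum type, so that a single point serves for
      both transforms.\<close>
    define m where "m = case_sum mu mu'"
    define t where "t = case_sum T T'"
    have sum_Plus: "sum f (N <+> N') = (\<Sum>n\<in>N. f (Inl n)) + (\<Sum>n\<in>N'. f (Inr n))"
      for f :: "nat + nat \<Rightarrow> real"
      using fin by (simp add: sum.Plus o_def)
    have m0: "m i \<ge> 0" for i
      using T(2) T'(2) by (auto simp: m_def less_imp_le split: sum.split)
    have "sum m (N <+> N') \<le> 2 * \<eta> * r"
      using 1 2 unfolding sum_Plus by (simp add: m_def N_def N'_def)
    then have "16 * sum m (N <+> N') / (\<delta> * r / 2) \<le> 16 * (2 * \<eta> * r) / (\<delta> * r / 2)"
      using \<delta> r by (intro divide_right_mono mult_left_mono) auto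
    also have "\<dots> = \<epsilon> / 4" using \<delta> r by (simp add: \<eta>_def)
    also have "\<dots> < \<epsilon> / 2" using \<epsilon> by simp
    finally have "16 * sum m (N <+> N') / (\<delta> * r / 2) < \<epsilon> / 2" .
    from exists_point_small_inverse_dist_sum[OF _ _ _ this, of "Re w" "Im w" t]
    obtain z where z: "Re z \<in> {Re w..Re w + \<delta> * r / 2}" "Im z \<in> {Im w..Im w + \<delta> * r / 2}"
      "\<And>i. i \<in> N <+> N' \<Longrightarrow> z \<noteq> t i"
      "(\<Sum>i\<in>N <+> N'. m i / norm (z - t i)) < \<epsilon> / 2"
      using m0 fin \<delta> r by auto
    have zw: "norm (z - w) \<le> \<delta> * r"
      using cmod_le[of "z - w"] z(1,2) by simp
    have "norm z \<le> norm (z - w) + norm w"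
      using norm_triangle_ineq[of "z - w" w] by simp
    moreover have "\<delta> * r \<le> 1 * r" using \<delta> r by (intro mult_right_mono) auto
    ultimately have z2: "norm z \<le> 2 * r" using zw w by simp
    have sums: "(\<Sum>n\<in>N. mu n / norm (z - T n)) + (\<Sum>n\<in>N'. mu' n / norm (z - T' n)) < \<epsilon> / 2"
      using z(4) unfolding sum_Plus by (simp add: m_def t_def)
    have "0 \<le> (\<Sum>n\<in>N. mu n / norm (z - T n))" "0 \<le> (\<Sum>n\<in>N'. mu' n / norm (z - T' n))"
      by (auto intro!: sum_nonneg divide_nonneg_nonneg less_imp_le[OF T(2)] less_imp_le[OF T'(2)])
    moreover have "norm (\<Sum>n. of_real (mu n) / (T n - z)) \<le> (\<Sum>n\<in>N. mu n / norm (z - T n)) + \<eta>"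
      "norm (\<Sum>n. of_real (mu' n) / (T' n - z)) \<le> (\<Sum>n\<in>N'. mu' n / norm (z - T' n)) + \<eta>"
      using 1 2 z2 unfolding N_def N'_def by blast+
    \<comment> \<open>Near poles are avoided by the choice of \<open>z\<close>; the others have
      modulus above \<open>4 * r\<close>, whereas \<open>norm z\<close> is at most
      \<open>2 * r\<close>.\<close>
    moreover have "z \<noteq> T n" for n
    proof (cases "n \<in> N")
      case True
      then show ?thesis using z(3)[of "Inl n"] by (auto simp: t_def)
    next
      case False
      then show ?thesis using z2 r by (auto simp: N_def)
    qed
    moreover have "z \<noteq> T' n" for n
    proof (cases "n \<in> N'")
      case True
      then show ?thesis using z(3)[of "Inr n"] by (auto simp: t_def)
    next
      case False
      then show ?thesis using z2 r by (auto simp: N'_def)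
    qed
    ultimately show "\<exists>z. norm (z - w) \<le> \<delta> * r \<and> z \<notin> range T \<and> z \<notin> range T' \<and>
      norm (\<Sum>n. of_real (mu n) / (T n - z)) \<le> \<epsilon> \<and>
      norm (\<Sum>n. of_real (mu' n) / (T' n - z)) \<le> \<epsilon>"
      using zw sums \<eta> by (intro exI[of _ z]) auto
  qed
qed

text \<open>The direction \<omega> makes the leading term positive along the ray. In a narrow sector
  around it this term turns little and dominates the rest.\<close>

lemma poly_Re_ge_1_in_sector:
  fixes p :: "complex poly"
  assumes "degree p \<noteq> 0"
  shows "\<exists>\<omega> \<delta> R. norm \<omega> = 1 \<and> 0 < \<delta> \<and> \<delta> < 1 \<and>
    (\<forall>r\<ge>R. \<forall>z. norm (z - of_real r * \<omega>) \<le> \<delta> * r \<longrightarrow> Re (poly p z) \<ge> 1)"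
proof -
  define d a where "d = degree p" and "a = lead_coeff p"
  have d: "d > 0" using assms by (simp add: d_def)
  have a: "a \<noteq> 0" using assms by (auto simp: a_def)
  define \<omega> where "\<omega> = cis (- Arg a / d)"
  have \<omega>: "norm \<omega> = 1" by (simp add: \<omega>_def)
  have \<omega>d: "\<omega> ^ d * a = of_real (norm a)"
  proof -
    have "\<omega> ^ d = cis (- Arg a)" using d by (simp add: \<omega>_def Complex.DeMoivre)
    moreover have "a = of_real (norm a) * cis (Arg a)"
      using a by (simp add: cis_Arg complex_sgn_def scaleR_conv_of_real)
    ultimately have "\<omega> ^ d * a = of_real (norm a) * (cis (- Arg a) * cis (Arg a))"
      by (metis mult.left_commute)
    then show ?thesis by (simp add: cis_mult)
  qed
  have "isCont (\<lambda>s :: complex. (1 + s) ^ d) 0" by (intro continuous_intros)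
  then obtain \<delta>0 where \<delta>0: "\<delta>0 > 0" "\<And>s :: complex. norm s < \<delta>0 \<Longrightarrow> norm ((1 + s) ^ d - 1) < 1/4"
    unfolding continuous_at_eps_delta by (force simp: dist_norm dest: spec[of _ "1/4"])
  define \<delta> where "\<delta> = min (\<delta>0 / 2) (1/2)"
  have \<delta>: "0 < \<delta>" "\<delta> < \<delta>0" "\<delta> \<le> 1/2" using \<delta>0(1) by (auto simp: \<delta>_def)
  have "\<forall>\<^sub>F z in at_infinity. dist (poly p z / z ^ d) a < norm a / 4"
    using poly_divide_tendsto_aux[of p] a unfolding d_def a_def
    by (intro tendstoD) auto
  then obtain b where b: "\<And>z. norm z \<ge> b \<Longrightarrow> norm (poly p z / z ^ d - a) < norm a / 4"
    by (auto simp: eventually_at_infinity dist_norm)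
  \<comment> \<open>The three bounds give \<open>r \<le> r ^ d\<close>,
    \<open>norm z \<ge> b\<close> (as \<open>norm z \<ge> r / 2\<close>), and the final estimate
    \<open>r * (norm a / 4) \<ge> 1\<close>.\<close>
  define R where "R = max 1 (max (2 * b) (4 / norm a))"
  have "Re (poly p z) \<ge> 1" if r: "r \<ge> R" and z: "norm (z - of_real r * \<omega>) \<le> \<delta> * r" for r z
  proof -
    have r1: "r \<ge> 1" "r \<ge> 2 * b" "r \<ge> 4 / norm a" using r by (auto simp: R_def)
    define s where "s = (z - of_real r * \<omega>) / (of_real r * \<omega>)"
    have \<omega>0: "\<omega> \<noteq> 0" using \<omega> by auto
    have zs: "z = of_real r * \<omega> * (1 + s)"
      using r1 \<omega>0 by (simp add: s_def field_simps)
    have "norm s \<le> \<delta>"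
      using z r1 \<omega> by (simp add: s_def norm_divide norm_mult pos_divide_le_eq)
    then have s: "norm ((1 + s) ^ d - 1) < 1/4" using \<delta> by (intro \<delta>0) auto
    have "norm (of_real r * \<omega>) \<le> norm z + norm (z - of_real r * \<omega>)"
      using norm_triangle_ineq4[of z "z - of_real r * \<omega>"] by simp
    moreover have "\<delta> * r \<le> 1/2 * r" using \<delta> r1 by (intro mult_right_mono) auto
    moreover have "norm (of_real r * \<omega>) = r" using r1 \<omega> by (simp add: norm_mult)
    ultimately have rz: "norm z \<ge> r / 2" using z by linarith
    then have z0: "z \<noteq> 0" using r1 by auto
    define e where "e = poly p z / z ^ d - a"
    have e: "norm e < norm a / 4" unfolding e_def using rz r1 by (intro b) auto
    define \<eta> where "\<eta> = (1 + s) ^ d - 1"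
    define x where "x = \<eta> * of_real (norm a) + (1 + \<eta>) * (\<omega> ^ d * e)"
    have "poly p z = z ^ d * (a + e)" using z0 by (simp add: e_def)
    also have "\<dots> = of_real r ^ d * ((1 + \<eta>) * (\<omega> ^ d * a + \<omega> ^ d * e))"
    proof -
      have "z ^ d = \<omega> ^ d * of_real r ^ d * (1 + \<eta>)"
        unfolding zs by (simp add: \<eta>_def power_mult_distrib)
      then show ?thesis by (simp add: algebra_simps)
    qed
    also have "\<dots> = of_real (r ^ d) * (of_real (norm a) + x)"
      unfolding \<omega>d by (simp add: x_def algebra_simps)
    finally have "Re (poly p z) = r ^ d * (norm a + Re x)" by simp
    \<comment> \<open>The error is 9/16 of \<open>norm a\<close>, below the 3/4 that may be
      lost.\<close>
    moreover have "norm x \<le> 1/4 * norm a + 5/4 * (norm a / 4)"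
    proof -
      have "norm (1 + \<eta>) \<le> 5/4"
        using norm_triangle_ineq[of 1 \<eta>] s by (simp add: \<eta>_def)
      then have "norm ((1 + \<eta>) * (\<omega> ^ d * e)) \<le> 5/4 * (norm a / 4)"
        unfolding norm_mult norm_power \<omega> using e by (intro mult_mono) auto
      moreover have "norm (\<eta> * of_real (norm a)) \<le> 1/4 * norm a"
        unfolding norm_mult using s by (intro mult_mono) (auto simp: \<eta>_def)
      ultimately show ?thesis unfolding x_def by (intro norm_triangle_mono)
    qed
    then have "norm a / 4 \<le> norm a + Re x"
      using abs_Re_le_cmod[of x] norm_ge_zero[of a] by linarith
    moreover have "r \<le> r ^ d" using power_increasing[of 1 d r] d r1 by simp
    then have "r * (norm a / 4) \<le> r ^ d * (norm a + Re x)"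
      using \<open>norm a / 4 \<le> norm a + Re x\<close> r1 by (intro mult_mono) auto
    ultimately have "r * (norm a / 4) \<le> Re (poly p z)" by simp
    moreover have "1 \<le> r * (norm a / 4)"
      using r1(3) a by (simp add: pos_divide_le_eq)
    ultimately show ?thesis by linarith
  qed
  with \<omega> \<delta> show ?thesis
    by (intro exI[of _ \<omega>] exI[of _ \<delta>] exI[of _ R]) auto
qed

lemma polynomial_growth_imp_poly:
  assumes "u holomorphic_on UNIV" and u: "\<And>z. norm (u z) \<le> C * (1 + norm z) ^ N"
  shows "\<exists>p. \<forall>z. u z = poly p z"
proof -
  have "norm (u 0) \<le> C" using u[of 0] by simp
  then have C: "C \<ge> 0" using norm_ge_zero[of "u 0"] by linarith
  have "norm (u z) \<le> (C * 2 ^ N) * norm z ^ N" if "1 \<le> norm z" for z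
  proof -
    have "(1 + norm z) ^ N \<le> (2 * norm z) ^ N" using that by (intro power_mono) auto
    then have "C * (1 + norm z) ^ N \<le> C * (2 * norm z) ^ N" using C by (intro mult_left_mono)
    then show ?thesis using u[of z] by (simp add: power_mult_distrib mult.assoc)
  qed
  from Liouville_polynomial[OF assms(1) this]
  have "u z = poly (\<Sum>k\<le>N. monom ((deriv ^^ k) u 0 / fact k) k) z" for z
    by (simp add: poly_sum poly_monom)
  then show ?thesis by blast
qed

section \<open>Recovering poles, masses and \<open>A\<close> from two zero sets\<close>

theorem theorem1p6:
  fixes T T' :: "nat \<Rightarrow> complex" and mu mu' :: "nat \<Rightarrow> real"
    and A A' :: "complex \<Rightarrow> complex" and \<alpha> \<beta> :: complex
  assumes "CdB_data T mu A" "CdB_convergence_class T mu" "CdB_finite_order A"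
    and "CdB_data T' mu' A'" "CdB_convergence_class T' mu'" "CdB_finite_order A'"
    and "\<alpha> \<noteq> 0" "\<beta> \<noteq> 0" "\<alpha> \<noteq> \<beta>"
    and "same_zeros_mult (CdB_B T mu A \<alpha>) (CdB_B T' mu' A' \<alpha>)"
    and "same_zeros_mult (CdB_B T mu A \<beta>) (CdB_B T' mu' A' \<beta>)"
  shows "range T' = range T
    \<and> (\<forall>n m. T' n = T m \<longrightarrow> mu' n = mu m)
    \<and> (\<exists>S. S holomorphic_on UNIV \<and> (\<forall>z. S z \<noteq> 0) \<and> (\<forall>z. A' z = S z * A z))"
proof -
  note D = CdB_dataD[OF assms(1)] and D' = CdB_dataD[OF assms(4)]
  \<comment> \<open>At a pole the value is \<open>- mu 0 * deriv A (T 0)\<close>, so no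
    \<open>CdB_B\<close> vanishes identically.\<close>
  have B0: "CdB_B T mu A \<gamma> (T 0) \<noteq> 0" for \<gamma>
    using D(3)[of 0] D(6)[of 0] inv_f_f[OF D(1), of 0] by (simp add: CdB_B_def)
  have growth: "exp_growth (CdB_B T mu A \<gamma>)" "exp_growth (CdB_B T' mu' A' \<gamma>)" for \<gamma>
    using assms(3,6) D(4) D'(4) unfolding CdB_finite_order_def
    by (intro CdB_B_exp_growth assms finite_order_imp_exp_growth; simp)+
  have quotient: "\<exists>P. P holomorphic_on UNIV \<and>
      (\<forall>z. CdB_B T' mu' A' \<gamma> z = exp (P z) * CdB_B T mu A \<gamma> z) \<and>
      (\<exists>p. \<forall>z. P z = poly p z)"
    if same: "same_zeros_mult (CdB_B T mu A \<gamma>) (CdB_B T' mu' A' \<gamma>)" for \<gamma>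
  proof -
    obtain P where P: "P holomorphic_on UNIV"
        "\<And>z. CdB_B T' mu' A' \<gamma> z = exp (P z) * CdB_B T mu A \<gamma> z"
      using same_zeros_imp_exp_quotient[OF CdB_B_holomorphic[OF assms(1,2)]
          CdB_B_holomorphic[OF assms(4,5)] same B0] by blast
    have "exp_growth (\<lambda>z. exp (P z) * CdB_B T mu A \<gamma> z)"
      using growth(2)[of \<gamma>] by (simp add: P(2)[symmetric])
    from log_quotient_growth[OF CdB_B_holomorphic[OF assms(1,2)] B0 P(1) growth(1) this]
    obtain C N where "\<And>z. norm (P z) \<le> C * (1 + norm z) ^ N" by blast
    then show ?thesis using polynomial_growth_imp_poly[OF P(1)] P by blast
  qed
  obtain P p where P: "P holomorphic_on UNIV" "\<And>z. P z = poly p z"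
      "\<And>z. CdB_B T' mu' A' \<alpha> z = exp (P z) * CdB_B T mu A \<alpha> z"
    using quotient[OF assms(10)] by blast
  obtain Q q where Q: "\<And>z. Q z = poly q z"
      "\<And>z. CdB_B T' mu' A' \<beta> z = exp (Q z) * CdB_B T mu A \<beta> z"
    using quotient[OF assms(11)] by blast
  define \<phi> where "\<phi> = (\<lambda>z. \<Sum>n. of_real (mu n) / (T n - z))"
  define \<phi>' where "\<phi>' = (\<lambda>z. \<Sum>n. of_real (mu' n) / (T' n - z))"
  define u where "u = p - q"
  have key: "exp (poly u z) * ((\<alpha> + \<phi> z) * (\<beta> + \<phi>' z)) = (\<beta> + \<phi> z) * (\<alpha> + \<phi>' z)"
    if z: "z \<notin> range T" "z \<notin> range T'" for z
  proof -
    have A0: "A z \<noteq> 0" "A' z \<noteq> 0" using z D(5) D'(5) by blast+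
    have B: "CdB_B T mu A \<gamma> z = A z * (\<gamma> + \<phi> z)" "CdB_B T' mu' A' \<gamma> z = A' z * (\<gamma> + \<phi>' z)" for \<gamma>
      using z by (simp_all add: CdB_B_def \<phi>_def \<phi>'_def)
    have 1: "A' z * (\<alpha> + \<phi>' z) = exp (P z) * (A z * (\<alpha> + \<phi> z))"
      using P(3)[of z] by (simp add: B)
    have 2: "A' z * (\<beta> + \<phi>' z) = exp (Q z) * (A z * (\<beta> + \<phi> z))"
      using Q(2)[of z] by (simp add: B)
    \<comment> \<open>The relations for \<alpha> and \<beta> are multiplied crosswise, so that
      \<open>A z * A' z\<close> cancels.\<close>
    have "exp (P z) * (A z * (\<alpha> + \<phi> z)) * (A' z * (\<beta> + \<phi>' z))
        = A' z * (\<alpha> + \<phi>' z) * (exp (Q z) * (A z * (\<beta> + \<phi> z)))"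
      unfolding 1 2 by (simp add: mult_ac)
    moreover have "exp (P z) = exp (poly u z) * exp (Q z)"
      by (simp add: u_def P(2) Q(1) exp_add[symmetric])
    ultimately have "(A z * A' z * exp (Q z)) * (exp (poly u z) * ((\<alpha> + \<phi> z) * (\<beta> + \<phi>' z)))
        = (A z * A' z * exp (Q z)) * ((\<beta> + \<phi> z) * (\<alpha> + \<phi>' z))"
      by (simp add: mult_ac)
    then show ?thesis using A0 by simp
  qed
  \<comment> \<open>For constant \<open>u\<close> any direction will do, since the last condition is
    then vacuous.\<close>
  obtain \<omega> \<delta> R0 where sector: "norm \<omega> = 1" "0 < \<delta>" "\<delta> < 1"
    "\<And>r z. degree u \<noteq> 0 \<Longrightarrow> r \<ge> R0 \<Longrightarrow> norm (z - of_real r * \<omega>) \<le> \<delta> * r \<Longrightarrow> Re (poly u z) \<ge> 1"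
  proof (cases "degree u = 0")
    case True
    then show ?thesis by (intro that[of 1 "1/2" 0]) auto
  next
    case False
    then show ?thesis using poly_Re_ge_1_in_sector[OF False] that by blast
  qed
  have "\<exists>z. z \<notin> range T \<and> z \<notin> range T' \<and> norm (\<phi> z) \<le> \<epsilon> \<and> norm (\<phi>' z) \<le> \<epsilon> \<and>
      (degree u \<noteq> 0 \<longrightarrow> Re (poly u z) \<ge> 1)" if \<epsilon>: "\<epsilon> > 0" for \<epsilon>
  proof -
    obtain R1 where R1: "\<And>r w. r \<ge> R1 \<Longrightarrow> norm w = r \<Longrightarrow>
      (\<exists>z. norm (z - w) \<le> \<delta> * r \<and> z \<notin> range T \<and> z \<notin> range T' \<and>
        norm (\<phi> z) \<le> \<epsilon> \<and> norm (\<phi>' z) \<le> \<epsilon>)"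
      using exists_point_small_transforms[OF D(2,3) assms(2) D'(2,3) assms(5) \<epsilon> sector(2,3)]
      unfolding \<phi>_def \<phi>'_def by blast
    define r where "r = max 0 (max R0 R1)"
    have "norm (of_real r * \<omega>) = r" using sector(1) by (simp add: norm_mult r_def)
    moreover have "R1 \<le> r" by (simp add: r_def)
    ultimately obtain z where z: "norm (z - of_real r * \<omega>) \<le> \<delta> * r"
      "z \<notin> range T" "z \<notin> range T'" "norm (\<phi> z) \<le> \<epsilon>" "norm (\<phi>' z) \<le> \<epsilon>"
      using R1[of r "of_real r * \<omega>"] by blast
    moreover have "degree u \<noteq> 0 \<longrightarrow> Re (poly u z) \<ge> 1"
      using sector(4)[of r z] z(1) by (auto simp: r_def)
    ultimately show ?thesis by blast
  qed
  then have "\<forall>k. \<exists>z. z \<notin> range T \<and> z \<notin> range T' \<and> norm (\<phi> z) \<le> 1 / Suc k \<and>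
      norm (\<phi>' z) \<le> 1 / Suc k \<and> (degree u \<noteq> 0 \<longrightarrow> Re (poly u z) \<ge> 1)"
    by simp
  from choice[OF this] obtain z where z: "\<And>k. z k \<notin> range T" "\<And>k. z k \<notin> range T'"
    "\<And>k. norm (\<phi> (z k)) \<le> 1 / Suc k" "\<And>k. norm (\<phi>' (z k)) \<le> 1 / Suc k"
    "\<And>k. degree u \<noteq> 0 \<Longrightarrow> Re (poly u (z k)) \<ge> 1"
    by blast
  have inv0: "(\<lambda>k. 1 / real (Suc k)) \<longlonglongrightarrow> 0"
    using LIMSEQ_inverse_real_of_nat by (simp add: inverse_eq_divide)
  have \<phi>0: "(\<lambda>k. \<phi> (z k)) \<longlonglongrightarrow> 0"
    by (rule Lim_null_comparison[OF _ inv0]) (use z(3) in auto)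
  have \<phi>'0: "(\<lambda>k. \<phi>' (z k)) \<longlonglongrightarrow> 0"
    by (rule Lim_null_comparison[OF _ inv0]) (use z(4) in auto)
  define X where "X = (\<lambda>k. (\<alpha> + \<phi> (z k)) * (\<beta> + \<phi>' (z k)))"
  define Y where "Y = (\<lambda>k. (\<beta> + \<phi> (z k)) * (\<alpha> + \<phi>' (z k)))"
  have "X \<longlonglongrightarrow> (\<alpha> + 0) * (\<beta> + 0)"
    unfolding X_def by (intro tendsto_intros \<phi>0 \<phi>'0)
  then have X: "X \<longlonglongrightarrow> \<alpha> * \<beta>" by simp
  have "Y \<longlonglongrightarrow> (\<beta> + 0) * (\<alpha> + 0)"
    unfolding Y_def by (intro tendsto_intros \<phi>0 \<phi>'0)
  then have Y: "Y \<longlonglongrightarrow> \<alpha> * \<beta>" by (simp add: mult.commute)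
  \<comment> \<open>Both limits equal \<open>\<alpha> * \<beta>\<close>, which is nonzero because
    neither parameter is 0.\<close>
  have "(\<lambda>k. Y k / X k) \<longlonglongrightarrow> (\<alpha> * \<beta>) / (\<alpha> * \<beta>)"
    using assms(7,8) by (intro tendsto_divide X Y) auto
  moreover have "\<forall>\<^sub>F k in sequentially. X k \<noteq> 0"
    using assms(7,8) by (intro tendsto_imp_eventually_ne[OF X]) auto
  then have "\<forall>\<^sub>F k in sequentially. Y k / X k = exp (poly u (z k))"
  proof eventually_elim
    case (elim k)
    then show ?case using key[OF z(1,2)[of k]] by (simp add: X_def Y_def divide_eq_eq)
  qed
  ultimately have "(\<lambda>k. exp (poly u (z k))) \<longlonglongrightarrow> (\<alpha> * \<beta>) / (\<alpha> * \<beta>)"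
    by (rule Lim_transform_eventually)
  moreover have "(\<alpha> * \<beta>) / (\<alpha> * \<beta>) = 1" using assms(7,8) by simp
  ultimately have lim1: "(\<lambda>k. exp (poly u (z k))) \<longlonglongrightarrow> 1" by (simp only:)
  have deg: "degree u = 0"
  proof (rule ccontr)
    assume "degree u \<noteq> 0"
    \<comment> \<open>The modulus of \<open>exp\<close> is \<open>exp\<close> of the real part,
      which is at least 1 along the sequence; this contradicts the limit 1.\<close>
    then have "exp 1 \<le> norm (exp (poly u (z k)))" for k using z(5) by simp
    then have "exp 1 \<le> norm (1 :: complex)"
      by (intro tendsto_lowerbound[OF tendsto_norm[OF lim1]]) auto
    then show False by simp
  qed
  then obtain c where c: "u = [:c:]" by (rule degree_eq_zeroE)
  \<comment> \<open>Here \<open>c\<close> may be a nonzero multiple of \<open>2 * pi * \<i>\<close>,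
    so only the exponentials of \<open>P\<close> and \<open>Q\<close> agree.\<close>
  have "exp c = 1" using lim1 by (simp add: c LIMSEQ_const_iff)
  then have PQ: "exp (P x) = exp (Q x)" for x
  proof -
    have "P x = c + Q x" using arg_cong[OF c, of "\<lambda>r. poly r x"] by (simp add: u_def P(2) Q(1) diff_eq_eq)
    then show ?thesis using \<open>exp c = 1\<close> by (simp add: exp_add)
  qed
  have A': "A' x = exp (P x) * A x" for x
  proof -
    \<comment> \<open>The series cancel in the difference, leaving multiples of \<open>A'\<close>
      and \<open>A\<close>; since \<alpha> and \<beta> differ, the factor can be divided
      out.\<close>
    have "(\<alpha> - \<beta>) * A' x = CdB_B T' mu' A' \<alpha> x - CdB_B T' mu' A' \<beta> x"
      by (simp add: CdB_B_eq_suminf[OF assms(4,5)] algebra_simps)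
    also have "\<dots> = exp (P x) * (CdB_B T mu A \<alpha> x - CdB_B T mu A \<beta> x)"
      by (simp add: P(3) Q(2) PQ right_diff_distrib)
    also have "\<dots> = (\<alpha> - \<beta>) * (exp (P x) * A x)"
      by (simp add: CdB_B_eq_suminf[OF assms(1,2)] algebra_simps)
    finally show ?thesis using assms(9) by simp
  qed
  have range: "range T' = range T"
  proof (intro set_eqI)
    fix x
    show "x \<in> range T' \<longleftrightarrow> x \<in> range T"
      using A'[of x] D(5)[of x] D'(5)[of x] by simp
  qed
  have "mu' n = mu m" if nm: "T' n = T m" for n m
  proof -
    define t where "t = T m"
    have inv: "inv T t = m" "inv T' t = n"
      using inv_f_f[OF D(1), of m] inv_f_f[OF D'(1), of n] nm by (simp_all add: t_def)
    have t: "t \<in> range T" by (simp add: t_def)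
    then have t': "t \<in> range T'" "A t = 0" using range D(5) by blast+
    have "((\<lambda>x. exp (P x) * A x) has_field_derivative exp (P t) * deriv P t * A t + exp (P t) * deriv A t) (at t)"
      using holomorphic_derivI[OF P(1) open_UNIV, of t] holomorphic_derivI[OF D(4) open_UNIV, of t]
      by (auto intro!: derivative_eq_intros simp: mult_ac)
    moreover have "A' = (\<lambda>x. exp (P x) * A x)" using A' by blast
    \<comment> \<open>The term with the derivative of \<open>P\<close> drops out because
      \<open>A t = 0\<close>.\<close>
    ultimately have dA': "deriv A' t = exp (P t) * deriv A t"
      using t'(2) by (simp add: DERIV_imp_deriv)
    \<comment> \<open>At a pole both sides are masses times derivatives, and by \<open>dA'\<close>
      the derivatives differ by the same factor \<open>exp (P t)\<close>, so the masses
      coincide.\<close>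
    have "CdB_B T' mu' A' \<alpha> t = exp (P t) * CdB_B T mu A \<alpha> t" by (rule P(3))
    then have "of_real (mu' n) * (exp (P t) * deriv A t) = of_real (mu m) * (exp (P t) * deriv A t)"
      using t t' inv dA' by (simp add: CdB_B_def mult_ac)
    moreover have "deriv A t \<noteq> 0" using D(6) by (simp add: t_def)
    ultimately show ?thesis by simp
  qed
  moreover have "(\<lambda>z. exp (P z)) holomorphic_on UNIV" by (intro holomorphic_intros P)
  ultimately show ?thesis using range A' by (intro conjI exI[of _ "\<lambda>z. exp (P z)"]) auto
qed

end
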